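(* Let $\nu,\mu\in\mathbb{C}$ with $\operatorname{Re}(\mu+\nu)<0$, let $a>0$ be real, and let $p\in\mathbb{C}$ with $\operatorname{Re}p>0$. Then $$ \begin{aligned} \exp\left(\tfrac12a^2p^2\right)D_\mu(ap)D_\nu(ap)&=\frac{1}{\Gamma[-\mu-\nu]}\int_0^\infty e^{-pt}\,a^{\mu+\nu}\,t^{-(1+\mu+\nu)}\exp\left(-\frac{t^2}{2a^2}\right)\\ &\qquad\times{}_2F_2\left(-\mu,-\nu;-\frac{\mu+\nu}{2},\frac{1-\mu-\nu}{2};\frac{t^2}{4a^2}\right)dt . \end{aligned} $$
   Context: $\Gamma[\cdot]$ is the gamma function and ${}_2F_2(a_1,a_2;b_1,b_2;z)=\sum_{n\ge0}\frac{(a_1)_n(a_2)_n}{(b_1)_n(b_2)_n}\frac{z^n}{n!}$ is the generalized hypergeometric function. $D_\nu(z)$ is Whittaker's parabolic cylinder function of order $\nu$, the entire function of $z$ given by $$D_\nu(z)=2^{\nu/2}e^{-z^2/4}\left\{\frac{\Gamma[1/2]}{\Gamma[(1-\nu)/2]}\Phi\left(-\frac{\nu}{2};\frac12;\frac{z^2}{2}\right)+\frac{z}{2^{1/2}}\frac{\Gamma[-1/2]}{\Gamma[-\nu/2]}\Phi\left(\frac{1-\nu}{2};\frac32;\frac{z^2}{2}\right)\right\},$$ where $\Phi(a;b;z)=\sum_{n\ge0}\frac{(a)_n}{(b)_n}\frac{z^n}{n!}$ is Kummer's confluent hypergeometric function and $1/\Gamma$ is taken to be $0$ at the nonpositive integers.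 *)

theory Defs
  imports "HOL-Analysis.Analysis"
begin

text \<open>Kummer's confluent hypergeometric function \<open>\<Phi>(a; b; z)\<close>.\<close>

definition kummer_Phi :: "complex \<Rightarrow> complex \<Rightarrow> complex \<Rightarrow> complex" where
  "kummer_Phi a b z = (\<Sum>n. pochhammer a n / pochhammer b n * (z ^ n / fact n))"

definition hypergeo_2F2 ::
    "complex \<Rightarrow> complex \<Rightarrow> complex \<Rightarrow> complex \<Rightarrow> complex \<Rightarrow> complex" where
  "hypergeo_2F2 a1 a2 b1 b2 z =
     (\<Sum>n. (pochhammer a1 n * pochhammer a2 n) / (pochhammer b1 n * pochhammer b2 n)
           * (z ^ n / fact n))"

text \<open>Both are the evaluations of the formal hypergeometric series of the library.\<close>

lemma kummer_Phi_eq_eval_fps: "kummer_Phi a b z = eval_fps (fps_hypergeo [a] [b] 1) z"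
  by (simp add: kummer_Phi_def eval_fps_def algebra_simps)

lemma hypergeo_2F2_eq_eval_fps:
  "hypergeo_2F2 a1 a2 b1 b2 z = eval_fps (fps_hypergeo [a1, a2] [b1, b2] 1) z"
  by (simp add: hypergeo_2F2_def eval_fps_def algebra_simps)

text \<open>
  Whittaker's parabolic cylinder function \<open>D\<^sub>\<nu>(z)\<close>.  The reciprocals of the Gamma function are
  written with the entire function \<^const>\<open>rGamma\<close>, which vanishes at the nonpositive integers.
\<close>

definition parabolic_cylinder_D :: "complex \<Rightarrow> complex \<Rightarrow> complex" where
  "parabolic_cylinder_D \<nu> z =
     2 powr (\<nu> / 2) * exp (- (z\<^sup>2) / 4) *
       (Gamma (1 / 2) * rGamma ((1 - \<nu>) / 2) * kummer_Phi (- \<nu> / 2) (1 / 2) (z\<^sup>2 / 2)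
        + z / of_real (sqrt 2) * (Gamma (- 1 / 2) * rGamma (- \<nu> / 2))
            * kummer_Phi ((1 - \<nu>) / 2) (3 / 2) (z\<^sup>2 / 2))"

end

theory Submission
  imports Defs "HOL-Complex_Analysis.Complex_Analysis" "HOL-Real_Asymp.Real_Asymp"
begin

text \<open>
  Write \<open>M\<^sub>z(\<alpha>)\<close> for the integral of \<open>t\<^bsup>\<alpha>-1\<^esup> exp (- z t - t\<^sup>2/2)\<close> over \<open>t > 0\<close>.
  Expanding \<open>exp (- z t)\<close> and using the duplication formula gives
  \<open>M\<^sub>z(\<alpha>) = \<Gamma>(\<alpha>) exp (z\<^sup>2/4) D\<^bsub>-\<alpha>\<^esub>(z)\<close>.  In the product \<open>M\<^sub>z(\<alpha>) M\<^sub>z(\<beta>)\<close>, a double integral over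
  \<open>s, t > 0\<close>, the factor \<open>exp (- (s\<^sup>2 + t\<^sup>2)/2)\<close> equals \<open>exp (- (s + t)\<^sup>2/2) exp (s t)\<close>; expanding
  \<open>exp (s t)\<close> leaves integrands depending on \<open>s + t\<close> apart from powers of \<open>s\<close> and \<open>t\<close>, which reduce to
  Beta functions times moments \<open>M\<^sub>z(\<alpha> + \<beta> + 2n)\<close>.  The resulting series is the termwise integral of the
  \<open>\<^sub>2F\<^sub>2\<close> integrand with \<open>z = a p\<close>, after the substitution \<open>u = t/a\<close>.

  This requires \<open>Re \<mu> < 0\<close> and \<open>Re \<nu> < 0\<close>.  For fixed \<open>\<gamma> = - (\<mu> + \<nu>)\<close> with \<open>Re \<gamma> > 0\<close>, the moments
  \<open>M\<^sub>z(\<gamma> + 2n)\<close> do not depend on \<open>\<mu>\<close>, so both sides are entire functions of \<open>\<mu>\<close> and the identity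
  theorem removes the restriction.
\<close>

section \<open>Series, integrals and holomorphy\<close>

text \<open>Dominated convergence for the partial sums. A single majorant of all sums of norms
  suffices; when an exponential factor is expanded, the exponential of the absolute value provides
  it.\<close>

lemma sums_integral_dominated:
  fixes f :: "nat \<Rightarrow> 'a \<Rightarrow> 'b::{banach, second_countable_topology}"
  assumes "\<And>n. integrable M (f n)" "integrable M w"
    and "\<And>x N. x \<in> space M \<Longrightarrow> (\<Sum>n<N. norm (f n x)) \<le> w x"
    and "\<And>x. x \<in> space M \<Longrightarrow> (\<lambda>n. f n x) sums g x"
    and "g \<in> borel_measurable M"
  shows "(\<lambda>n. integral\<^sup>L M (f n)) sums integral\<^sup>L M g"
proof -
  have "(\<lambda>N. \<integral>x. (\<Sum>n<N. f n x) \<partial>M) \<longlonglongrightarrow> integral\<^sup>L M g"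
  proof (rule integral_dominated_convergence[where w = w])
    show "AE x in M. (\<lambda>N. \<Sum>n<N. f n x) \<longlonglongrightarrow> g x"
      using assms(4) by (intro AE_I2) (simp add: sums_def)
    show "AE x in M. norm (\<Sum>n<N. f n x) \<le> w x" for N
      using assms(3) by (intro AE_I2 order_trans[OF norm_sum]) auto
  qed (use assms in auto)
  thus ?thesis
    using assms(1) by (simp add: sums_def)
qed

section \<open>Pochhammer estimates and majorants for hypergeometric series\<close>

lemma summable_of_ratio_tendsto:
  fixes f :: "nat \<Rightarrow> real"
  assumes "\<And>n. f n > 0" "(\<lambda>n. f (Suc n) / f n) \<longlonglongrightarrow> L" "L < 1"
  shows "summable f"
proof -
  obtain c where c: "L < c" "c < 1"
    using dense assms(3) by blast
  obtain N where "\<And>n. n \<ge> N \<Longrightarrow> f (Suc n) / f n < c"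
    using order_tendstoD(2)[OF assms(2) c(1)] by (auto simp: eventually_sequentially)
  hence "norm (f (Suc n)) \<le> c * norm (f n)" if "n \<ge> N" for n
    using that assms(1)[of n] assms(1)[of "Suc n"] by (fastforce simp: divide_simps)
  thus ?thesis
    by (rule summable_ratio_test[OF c(2)])
qed

lemma norm_pochhammer_le:
  "norm (pochhammer a n) \<le> pochhammer (norm a) n" for a :: complex
  unfolding pochhammer_prod prod_norm[symmetric]
  by (intro prod_mono) (auto intro: order_trans[OF norm_triangle_ineq])

lemma pochhammer_mono_real:
  "0 \<le> a \<Longrightarrow> a \<le> b \<Longrightarrow> pochhammer a n \<le> pochhammer (b :: real) n"
  unfolding pochhammer_prod by (intro prod_mono) auto

text \<open>Factor by factor, a modulus is at least the real part. This bounds the denominators of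
  the complex series from below.\<close>

lemma pochhammer_Re_le_norm:
  "Re a > 0 \<Longrightarrow> pochhammer (Re a) n \<le> norm (pochhammer a n)" for a :: complex
  unfolding pochhammer_prod prod_norm[symmetric]
  using complex_Re_le_cmod[of "a + of_nat n" for n] by (intro prod_mono) (auto simp: add_nonneg_nonneg)

text \<open>The ratio of consecutive terms tends to 0, because the denominator has one more linear
  factor than the numerator. Positive parameters keep the terms positive, as the ratio test above
  requires; the series then serves as a majorant for complex parameters.\<close>

lemma summable_2F2_real:
  fixes A B b c R :: real
  assumes "A > 0" "B > 0" "b > 0" "c > 0" "R > 0"
  shows "summable (\<lambda>n. pochhammer A n * pochhammer B n / (pochhammer b n * pochhammer c n)
           * (R ^ n / fact n))"
    (is "summable ?f")
proof (rule summable_of_ratio_tendsto[where L = 0])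
  show "?f n > 0" for n
    using assms by (simp add: pochhammer_pos)
  have "(\<lambda>n. (A + real n) * (B + real n) / ((b + real n) * (c + real n)) * (R / real (Suc n))) \<longlonglongrightarrow> 0"
    using assms by real_asymp
  also have "(\<lambda>n. (A + real n) * (B + real n) / ((b + real n) * (c + real n)) * (R / real (Suc n))) =
     (\<lambda>n. ?f (Suc n) / ?f n)"
  proof
    fix n
    have "pochhammer A n > 0" "pochhammer B n > 0" "pochhammer b n > 0" "pochhammer c n > 0"
      "b + real n > 0" "c + real n > 0"
      using assms by (simp_all add: pochhammer_pos)
    thus "(A + real n) * (B + real n) / ((b + real n) * (c + real n)) * (R / real (Suc n)) =
        ?f (Suc n) / ?f n"
      using assms by (simp add: pochhammer_Suc divide_simps)
  qed
  finally show "(\<lambda>n. ?f (Suc n) / ?f n) \<longlonglongrightarrow> 0" .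
qed simp

text \<open>Kummer's series is a 2F2 series in which the parameter 1 occurs above and below and
  cancels.\<close>

lemma summable_kummer_real:
  fixes A b R :: real
  assumes "A > 0" "b > 0" "R > 0"
  shows "summable (\<lambda>n. pochhammer A n / pochhammer b n * (R ^ n / fact n))"
proof -
  have "pochhammer (1 :: real) n \<noteq> 0" for n
    using pochhammer_pos[of "1 :: real" n] by simp
  thus ?thesis
    using summable_2F2_real[of A 1 b 1 R] assms by simp
qed

text \<open>Gauss's 2F1 series inside the unit disc: the ratio of consecutive terms tends to
  \<open>x\<close>. Integrating the 2F2 terms against the Gaussian kernel cancels one lower
  parameter, so the bounds on those integrals form a series of this type at
  \<open>x = 1 / 2\<close>.\<close>

lemma summable_gauss_real:
  fixes A B c x :: real
  assumes "A > 0" "B > 0" "c > 0" "0 < x" "x < 1"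
  shows "summable (\<lambda>n. pochhammer A n * pochhammer B n / pochhammer c n * (x ^ n / fact n))"
proof (rule summable_of_ratio_tendsto[where L = x])
  show "pochhammer A n * pochhammer B n / pochhammer c n * (x ^ n / fact n) > 0" for n
    using assms by (simp add: pochhammer_pos)
  have "(\<lambda>n. (A + real n) * (B + real n) / (c + real n) * (x / real (Suc n))) \<longlonglongrightarrow> x"
    using assms by real_asymp
  also have "(\<lambda>n. (A + real n) * (B + real n) / (c + real n) * (x / real (Suc n))) =
     (\<lambda>n. (pochhammer A (Suc n) * pochhammer B (Suc n) / pochhammer c (Suc n) * (x ^ Suc n / fact (Suc n))) /
          (pochhammer A n * pochhammer B n / pochhammer c n * (x ^ n / fact n)))"
  proof
    fix n
    have "pochhammer A n > 0" "pochhammer B n > 0" "pochhammer c n > 0" "c + real n > 0"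
      using assms by (simp_all add: pochhammer_pos)
    thus "(A + real n) * (B + real n) / (c + real n) * (x / real (Suc n)) =
       (pochhammer A (Suc n) * pochhammer B (Suc n) / pochhammer c (Suc n) * (x ^ Suc n / fact (Suc n))) /
          (pochhammer A n * pochhammer B n / pochhammer c n * (x ^ n / fact n))"
      using assms by (simp add: pochhammer_Suc divide_simps)
  qed
  finally show "(\<lambda>n. (pochhammer A (Suc n) * pochhammer B (Suc n) / pochhammer c (Suc n) * (x ^ Suc n / fact (Suc n))) /
          (pochhammer A n * pochhammer B n / pochhammer c n * (x ^ n / fact n))) \<longlonglongrightarrow> x" .
qed (use assms in simp)

section \<open>Entire dependence of series on a parameter\<close>

lemma holomorphic_suminf:
  fixes f :: "nat \<Rightarrow> complex \<Rightarrow> complex"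
  assumes "\<And>n. f n holomorphic_on UNIV"
    and "\<And>R. R > 0 \<Longrightarrow> \<exists>M. summable M \<and> (\<forall>n w. norm w \<le> R \<longrightarrow> norm (f n w) \<le> M n)"
  shows "(\<lambda>w. \<Sum>n. f n w) holomorphic_on UNIV"
proof (rule holomorphic_uniform_sequence[where f = "\<lambda>N w. \<Sum>n<N. f n w"])
  fix w :: complex
  \<comment> \<open>The disc of radius \<open>norm w + 1\<close> about 0 contains the closed unit
    disc about \<open>w\<close>, so the M-test gives uniform convergence near
    \<open>w\<close>.\<close>
  obtain M where M: "summable M" "\<And>n v. norm v \<le> norm w + 1 \<Longrightarrow> norm (f n v) \<le> M n"
    using assms(2)[of "norm w + 1"] by (auto simp: add_nonneg_pos)
  have "uniform_limit (cball w 1) (\<lambda>N w. \<Sum>n<N. f n w) (\<lambda>w. \<Sum>n. f n w) sequentially"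
  proof (rule Weierstrass_m_test[OF _ M(1)])
    fix n v assume "v \<in> cball w 1"
    hence "norm v \<le> norm w + 1"
      using norm_triangle_ineq2[of v w] by (auto simp: dist_norm norm_minus_commute)
    thus "norm (f n v) \<le> M n" by (rule M(2))
  qed
  thus "\<exists>d>0. cball w d \<subseteq> UNIV \<and>
      uniform_limit (cball w d) (\<lambda>N w. \<Sum>n<N. f n w) (\<lambda>w. \<Sum>n. f n w) sequentially"
    by (intro exI[of _ 1]) auto
qed (auto intro!: holomorphic_intros assms)

lemma holomorphic_pochhammer [holomorphic_intros]:
  "f holomorphic_on A \<Longrightarrow> (\<lambda>w. pochhammer (f w) n) holomorphic_on A"
  unfolding pochhammer_prod by (intro holomorphic_intros)

text \<open>The bound is uniform over the discs \<open>norm a \<le> A\<close> and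
  \<open>norm z \<le> R\<close>, so it yields both convergence and holomorphy in the numerator
  parameter.\<close>

lemma norm_kummer_term_le:
  fixes a z :: complex and b A R :: real
  assumes "norm a \<le> A" "b > 0" "norm z \<le> R"
  shows "norm (pochhammer a n / pochhammer (of_real b) n * (z ^ n / fact n))
    \<le> pochhammer A n / pochhammer b n * (R ^ n / fact n)"
proof -
  have A: "norm (pochhammer a n) \<le> pochhammer A n"
    using norm_pochhammer_le[of a n] pochhammer_mono_real[of "norm a" A n] assms by simp
  moreover have "norm (z ^ n) \<le> R ^ n"
    using assms by (simp add: norm_power power_mono)
  ultimately show ?thesis
    using assms order_trans[OF norm_ge_zero A]
      pochhammer_pos[of b n]
    by (auto simp: norm_mult norm_divide pochhammer_of_real norm_power abs_of_pos
        intro!: mult_mono divide_right_mono)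
qed

lemma summable_kummer:
  fixes a z :: complex and b :: real
  assumes "b > 0"
  shows "summable (\<lambda>n. pochhammer a n / pochhammer (of_real b) n * (z ^ n / fact n))"
proof (rule summable_comparison_test'[where N = 0])
  show "summable (\<lambda>n. pochhammer (norm a + 1) n / pochhammer b n * ((norm z + 1) ^ n / fact n))"
    using assms by (intro summable_kummer_real) (auto simp: add_nonneg_pos)
qed (use assms norm_kummer_term_le in simp)

lemma holomorphic_kummer_Phi:
  fixes z :: complex and b :: real
  assumes "b > 0"
  shows "(\<lambda>a. kummer_Phi a (of_real b) z) holomorphic_on UNIV"
  unfolding kummer_Phi_def
proof (rule holomorphic_suminf)
  fix R :: real assume "R > 0"
  thus "\<exists>M. summable M \<and> (\<forall>n w. norm w \<le> R \<longrightarrow>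
      norm (pochhammer w n / pochhammer (of_real b) n * (z ^ n / fact n)) \<le> M n)"
    using assms norm_kummer_term_le summable_kummer_real[of R b "norm z + 1"]
    by (intro exI[of _ "\<lambda>n. pochhammer R n / pochhammer b n * ((norm z + 1) ^ n / fact n)"])
       (auto simp: add_nonneg_pos)
qed (use assms in \<open>auto intro!: holomorphic_intros simp: pochhammer_of_real pochhammer_pos less_imp_neq [symmetric]\<close>)

text \<open>The order enters only through powers of 2, the entire function \<open>rGamma\<close>,
  and the numerator parameters of two Kummer series with fixed denominators 1/2 and 3/2.\<close>

lemma holomorphic_parabolic_cylinder_D:
  assumes "f holomorphic_on UNIV"
  shows "(\<lambda>\<nu>. parabolic_cylinder_D (f \<nu>) z) holomorphic_on UNIV"
proof -
  have kummer: "(\<lambda>\<nu>. kummer_Phi (g \<nu>) (of_real b) w) holomorphic_on UNIV"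
    if "g holomorphic_on UNIV" "b > 0" for g w and b :: real
    using holomorphic_on_compose_gen[OF that(1) holomorphic_kummer_Phi[OF that(2), of w]]
    by (simp add: o_def)
  have "(\<lambda>\<nu>. kummer_Phi (- f \<nu> / 2) (1 / 2) (z\<^sup>2 / 2)) holomorphic_on UNIV"
       "(\<lambda>\<nu>. kummer_Phi ((1 - f \<nu>) / 2) (3 / 2) (z\<^sup>2 / 2)) holomorphic_on UNIV"
    using kummer[of "\<lambda>\<nu>. - f \<nu> / 2" "1/2"] kummer[of "\<lambda>\<nu>. (1 - f \<nu>) / 2" "3/2"]
      holomorphic_on_divide[OF holomorphic_on_minus[OF assms] holomorphic_on_const[of 2]]
      holomorphic_on_divide[OF holomorphic_on_diff[OF holomorphic_on_const[of 1] assms] holomorphic_on_const[of 2]]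
    by auto
  thus ?thesis
    unfolding parabolic_cylinder_D_def by (intro holomorphic_intros assms) auto
qed

section \<open>Gaussian moments\<close>

text \<open>The indicator makes this a function on the whole line, so translations and dilations of
  \<open>lborel\<close> apply without tracking domains. The exponent \<open>\<alpha> - 1\<close>
  follows the Mellin convention, under which parameters add in convolutions.\<close>

definition pos_powr :: "complex \<Rightarrow> real \<Rightarrow> complex" where
  "pos_powr \<alpha> t = indicator {0<..} t *\<^sub>R (of_real t powr (\<alpha> - 1))"

lemma measurable_pos_powr [measurable]: "pos_powr \<alpha> \<in> borel_measurable borel"
proof -
  have "continuous_on {0<..} (\<lambda>t. complex_of_real t powr (\<alpha> - 1))"
    by (intro continuous_intros) (auto simp: nonpos_Reals_def)
  thus ?thesis
    unfolding pos_powr_def by (intro borel_measurable_continuous_on_indicator) auto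
qed

lemma pos_powr_add_nat: "pos_powr (\<alpha> + of_nat n) t = of_real t ^ n * pos_powr \<alpha> t"
proof (cases "t > 0")
  case True
  have "complex_of_real t powr (\<alpha> + of_nat n - 1) = of_real t powr (\<alpha> - 1 + of_nat n)"
    by (simp add: algebra_simps)
  also have "\<dots> = of_real t powr (\<alpha> - 1) * of_real t ^ n"
    using True by (subst powr_add) (simp add: powr_nat')
  finally show ?thesis
    using True by (simp add: pos_powr_def)
qed (simp add: pos_powr_def)

lemma pos_powr_mult: "u > 0 \<Longrightarrow> pos_powr \<alpha> (u * x) = of_real u powr (\<alpha> - 1) * pos_powr \<alpha> x"
  by (auto simp: pos_powr_def zero_less_mult_iff powr_times_real split: split_indicator)

lemma
  assumes "Re \<alpha> > 0"
  shows integrable_pos_powr_exp: "integrable lborel (\<lambda>t. pos_powr \<alpha> t * exp (- of_real t))"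
    and integral_pos_powr_exp: "(\<integral>t. pos_powr \<alpha> t * exp (- of_real t) \<partial>lborel) = Gamma \<alpha>"
proof -
  define f where "f = (\<lambda>t. complex_of_real t powr (\<alpha> - 1) / of_real (exp t))"
  have eq: "indicator {0<..} t *\<^sub>R f t = pos_powr \<alpha> t * exp (- of_real t)" for t
    by (simp add: f_def pos_powr_def exp_minus exp_of_real divide_inverse)
  \<comment> \<open>Absolute integrability refers to the completed measure; Borel measurability of
    the integrand brings it down to \<open>lborel\<close>.\<close>
  have "set_integrable lebesgue {0<..} f"
    unfolding f_def using absolutely_integrable_Gamma_integral'[OF assms] .
  hence int: "set_integrable lborel {0<..} f"
    unfolding set_integrable_def eq by (subst (asm) integrable_completion) measurable
  thus "integrable lborel (\<lambda>t. pos_powr \<alpha> t * exp (- of_real t))"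
    unfolding set_integrable_def eq .
  show "(\<integral>t. pos_powr \<alpha> t * exp (- of_real t) \<partial>lborel) = Gamma \<alpha>"
    using set_borel_integral_eq_integral(2)[OF int]
      integral_unique[OF Gamma_integral_complex'[OF assms]]
    by (simp add: set_lebesgue_integral_def eq) (simp add: f_def)
qed

section \<open>Gaussian kernels, their norms and their integrability\<close>

definition gauss_kernel :: "complex \<Rightarrow> complex \<Rightarrow> real \<Rightarrow> complex" where
  "gauss_kernel z \<alpha> t = pos_powr \<alpha> t * exp (- (z * of_real t) - (of_real t)\<^sup>2 / 2)"

text \<open>The function written \<open>M\<^sub>z(\<alpha>)\<close> in the overview: the Mellin
  transform of \<open>exp (- z t - t\<^sup>2/2)\<close>.\<close>

definition gauss_moment :: "complex \<Rightarrow> complex \<Rightarrow> complex" where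
  "gauss_moment z \<alpha> = (\<integral>t. gauss_kernel z \<alpha> t \<partial>lborel)"

lemma measurable_gauss_kernel [measurable]: "gauss_kernel z \<alpha> \<in> borel_measurable borel"
  unfolding gauss_kernel_def by measurable

text \<open>The Gaussian factor outweighs \<open>exp (- z t)\<close> for every complex
  \<open>z\<close>, leaving a constant multiple of the integrand of Euler's Gamma integral as
  majorant.\<close>

lemma integrable_gauss_kernel:
  assumes "Re \<alpha> > 0"
  shows "integrable lborel (gauss_kernel z \<alpha>)"
proof -
  define f where "f = (\<lambda>t. pos_powr \<alpha> t * exp (- of_real t))"
  have "integrable lborel f"
    unfolding f_def using integrable_pos_powr_exp[OF assms] .
  hence "integrable lborel (\<lambda>t. of_real (exp ((1 + norm z)\<^sup>2 / 2)) * f t)"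
    by (rule integrable_mult_right)
  thus ?thesis
  proof (rule Bochner_Integration.integrable_bound)
    have "norm (gauss_kernel z \<alpha> t)
        \<le> norm (of_real (exp ((1 + norm z)\<^sup>2 / 2)) * f t)" for t
    proof (cases "t > 0")
      case True
      have "- (Re z * t) \<le> norm z * t"
        using True complex_Re_le_cmod[of "- z"] mult_right_mono[of "- Re z" "norm z" t] by simp
      \<comment> \<open>Completing the square: this says (1 + |z|) t - t^2/2 \<le> (1 + |z|)^2/2.
        The extra 1 leaves the decay exp (- t) after |z| t is absorbed.\<close>
      moreover have "0 \<le> (t - (1 + norm z))\<^sup>2" by simp
      ultimately have "- (Re z * t) - t\<^sup>2 / 2 \<le> (1 + norm z)\<^sup>2 / 2 - t"
        by (simp add: power2_eq_square algebra_simps)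
      hence "exp (- (Re z * t) - t\<^sup>2 / 2) \<le> exp ((1 + norm z)\<^sup>2 / 2) * exp (- t)"
        by (simp flip: exp_add)
      hence "norm (pos_powr \<alpha> t) * exp (- (Re z * t) - t\<^sup>2 / 2)
          \<le> norm (pos_powr \<alpha> t) * (exp ((1 + norm z)\<^sup>2 / 2) * exp (- t))"
        by (rule mult_left_mono) simp
      moreover have "Re ((complex_of_real t)\<^sup>2) = t\<^sup>2"
        by (simp flip: of_real_power)
      ultimately show ?thesis
        by (simp add: gauss_kernel_def f_def norm_mult mult_ac)
    qed (simp add: gauss_kernel_def pos_powr_def)
    thus "AE t in lborel. norm (gauss_kernel z \<alpha> t)
        \<le> norm (of_real (exp ((1 + norm z)\<^sup>2 / 2)) * f t)"
      by simp
  qed simp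
qed

lemma gauss_kernel_add_nat:
  "gauss_kernel z (\<alpha> + of_nat n) t = of_real t ^ n * gauss_kernel z \<alpha> t"
  by (simp add: gauss_kernel_def pos_powr_add_nat mult_ac)

lemma gauss_kernel_exp:
  "gauss_kernel (z + w) \<alpha> t = exp (- (z * of_real t)) * gauss_kernel w \<alpha> t"
proof -
  have "exp (- ((z + w) * of_real t) - (of_real t)\<^sup>2 / 2) =
      exp (- (z * of_real t)) * exp (- (w * of_real t) - (complex_of_real t)\<^sup>2 / 2)"
    by (simp add: algebra_simps flip: exp_add)
  thus ?thesis
    by (simp add: gauss_kernel_def)
qed

text \<open>The modulus of a kernel is the kernel with the real parts as parameters. Stating this in
  the complex numbers lets the moment formulas evaluate integrals of norms as well.\<close>

lemma norm_gauss_kernel: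
  "of_real (norm (gauss_kernel z \<alpha> t)) = gauss_kernel (of_real (Re z)) (of_real (Re \<alpha>)) t"
proof (cases "t > 0")
  case True
  have "Re ((complex_of_real t)\<^sup>2) = t\<^sup>2"
    by (simp flip: of_real_power)
  hence "norm (gauss_kernel z \<alpha> t) = t powr (Re \<alpha> - 1) * exp (- (Re z * t) - t\<^sup>2 / 2)"
    using True by (simp add: gauss_kernel_def pos_powr_def norm_mult norm_powr_real_powr)
  thus ?thesis
    using True by (simp add: gauss_kernel_def pos_powr_def powr_of_real [symmetric] exp_of_real [symmetric])
qed (simp add: gauss_kernel_def pos_powr_def)

lemma norm_gauss_kernel_le:
  assumes "Re z \<ge> 0"
  shows "norm (gauss_kernel z \<alpha> t) \<le> norm (gauss_kernel 0 \<alpha> t)"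
proof (cases "t > 0")
  case True
  thus ?thesis
    using assms gauss_kernel_exp[of z 0 \<alpha> t] by (simp add: norm_mult mult_left_le_one_le)
qed (simp add: gauss_kernel_def pos_powr_def)

lemma integral_norm_gauss_kernel:
  "of_real (\<integral>t. norm (gauss_kernel z \<alpha> t) \<partial>lborel) =
     gauss_moment (of_real (Re z)) (of_real (Re \<alpha>))"
  unfolding gauss_moment_def norm_gauss_kernel[symmetric] by simp

text \<open>The substitution of t^2/2 for the variable turns Euler's integral for
  \<Gamma>(\<alpha>/2) into a Gaussian moment.\<close>

lemma gauss_moment_0:
  assumes "Re \<alpha> > 0"
  shows "gauss_moment 0 \<alpha> = 2 powr (\<alpha> / 2 - 1) * Gamma (\<alpha> / 2)"
proof -
  define f where "f = (\<lambda>t. complex_of_real t powr (\<alpha> / 2 - 1) * exp (- of_real t))"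
  have re: "Re (\<alpha> / 2) > 0" using assms by simp
  have cont: "continuous_on {0<..} f"
    unfolding f_def by (intro continuous_intros) (auto simp: nonpos_Reals_def)
  have f_eq: "indicator {0<..} t *\<^sub>R f t = pos_powr (\<alpha> / 2) t * exp (- of_real t)" for t
    by (simp add: f_def pos_powr_def)
  have int: "set_integrable lborel {0<..} f"
    unfolding set_integrable_def f_eq by (rule integrable_pos_powr_exp[OF re])
  have "(LBINT t:{0<..}. f t) = Gamma (\<alpha> / 2)"
    unfolding set_lebesgue_integral_def f_eq by (rule integral_pos_powr_exp[OF re])
  \<comment> \<open>The Jacobian \<open>t\<close> times (t^2/2)^(\<alpha>/2 - 1) is 2^(1 -
    \<alpha>/2) t^(\<alpha> - 1). All powers are rewritten as exponentials of ln t and ln 2, so that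
    only exponents have to be compared.\<close>
  have subst: "t *\<^sub>R f (t\<^sup>2 / 2) = 2 powr (1 - \<alpha> / 2) * (of_real t powr (\<alpha> - 1) * exp (- ((of_real t)\<^sup>2 / 2)))"
    if "t > 0" for t
  proof -
    have "complex_of_real (t\<^sup>2 / 2) powr (\<alpha> / 2 - 1) =
        exp ((\<alpha> / 2 - 1) * (2 * of_real (ln t) - of_real (ln 2)))"
      using that by (simp add: powr_def Ln_of_real ln_div ln_realpow flip: of_real_power of_real_divide)
    moreover have "(2::complex) powr (1 - \<alpha> / 2) = exp ((1 - \<alpha> / 2) * of_real (ln 2))"
      using Ln_of_real[of 2] by (simp add: powr_def)
    moreover have "complex_of_real t powr (\<alpha> - 1) = exp ((\<alpha> - 1) * of_real (ln t))"
      using that by (simp add: powr_def Ln_of_real)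
    moreover have "complex_of_real t = exp (of_real (ln t))"
      using that by (simp only: exp_of_real exp_ln)
    moreover have "exp (of_real (ln t)) * exp ((\<alpha> / 2 - 1) * (2 * of_real (ln t) - of_real (ln 2))) =
        exp ((1 - \<alpha> / 2) * complex_of_real (ln 2)) * exp ((\<alpha> - 1) * of_real (ln t))"
      by (simp add: algebra_simps flip: exp_add)
    ultimately show ?thesis
      by (simp add: f_def scaleR_conv_of_real exp_minus divide_simps flip: exp_of_real)
  qed
  have kernel: "indicator {0<..} t *\<^sub>R (t *\<^sub>R f (t\<^sup>2 / 2)) = 2 powr (1 - \<alpha> / 2) * gauss_kernel 0 \<alpha> t" for t
    using subst[of t] by (cases "t > 0") (auto simp: gauss_kernel_def pos_powr_def)
  have "(LBINT t=ereal 0..\<infinity>. f t) = (LBINT t=ereal 0..\<infinity>. t *\<^sub>R f (t\<^sup>2 / 2))"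
  proof (rule interval_integral_substitution_integrable)
    show "set_integrable lborel (einterval (ereal 0) \<infinity>) (\<lambda>t. t *\<^sub>R f (t\<^sup>2 / 2))"
      unfolding einterval_eq set_integrable_def kernel
      by (intro integrable_mult_right integrable_gauss_kernel assms)
    show "((ereal \<circ> (\<lambda>t. t\<^sup>2 / 2) \<circ> real_of_ereal) \<longlongrightarrow> ereal 0) (at_right (ereal 0))"
      unfolding o_def at_right_ereal filterlim_filtermap
      by (auto intro!: tendsto_eq_intros simp: filterlim_filtermap)
    show "((ereal \<circ> (\<lambda>t. t\<^sup>2 / 2) \<circ> real_of_ereal) \<longlongrightarrow> \<infinity>) (at_left \<infinity>)"
      unfolding o_def at_left_PInf filterlim_filtermap real_of_ereal.simps
      unfolding tendsto_PInfty_eq_at_top by real_asymp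
    show "isCont f (t\<^sup>2 / 2)" if "ereal 0 < ereal t" for t
      using cont that by (intro continuous_on_interior[of "{0<..}"]) (auto simp: interior_open)
    show "DERIV (\<lambda>t. t\<^sup>2 / 2) t :> t" for t :: real
      by (auto intro!: derivative_eq_intros)
  qed (use int in \<open>auto simp: einterval_eq\<close>)
  hence "Gamma (\<alpha> / 2) = 2 powr (1 - \<alpha> / 2) * gauss_moment 0 \<alpha>"
    using \<open>(LBINT t:{0<..}. f t) = Gamma (\<alpha> / 2)\<close>
    unfolding interval_integral_to_infinity_eq set_lebesgue_integral_def kernel gauss_moment_def
    by simp
  hence "2 powr (\<alpha> / 2 - 1) * Gamma (\<alpha> / 2) =
      (2 powr (\<alpha> / 2 - 1) * 2 powr (1 - \<alpha> / 2)) * gauss_moment 0 \<alpha>"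
    by (simp add: mult_ac)
  also have "(2::complex) powr (\<alpha> / 2 - 1) * 2 powr (1 - \<alpha> / 2) = 1"
    by (simp flip: powr_add)
  finally show ?thesis by simp
qed

section \<open>Parabolic cylinder functions as Gaussian moments\<close>

text \<open>Expansion of exp (- z t) and termwise integration. The sums of norms are dominated by
  the kernel with \<open>z\<close> replaced by - |z|, which is still integrable.\<close>

lemma gauss_moment_sums:
  assumes "Re \<alpha> > 0"
  shows "(\<lambda>n. (- z) ^ n / fact n * gauss_moment 0 (\<alpha> + of_nat n)) sums gauss_moment z \<alpha>"
proof -
  have "(\<lambda>n. \<integral>t. (- z) ^ n / fact n * gauss_kernel 0 (\<alpha> + of_nat n) t \<partial>lborel)
      sums (\<integral>t. gauss_kernel z \<alpha> t \<partial>lborel)"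
  proof (rule sums_integral_dominated)
    show "integrable lborel (\<lambda>t. (- z) ^ n / fact n * gauss_kernel 0 (\<alpha> + of_nat n) t)" for n
      using assms by (intro integrable_mult_right integrable_gauss_kernel) (simp add: add_pos_nonneg)
    show "integrable lborel (\<lambda>t. norm (gauss_kernel (- of_real (norm z)) \<alpha> t))"
      using assms by (intro integrable_norm integrable_gauss_kernel)
    fix t :: real
    have summand: "(- z) ^ n / fact n * gauss_kernel 0 (\<alpha> + of_nat n) t =
        (- (z * of_real t)) ^ n /\<^sub>R fact n * gauss_kernel 0 \<alpha> t" for n
      by (simp add: gauss_kernel_add_nat scaleR_conv_of_real power_mult_distrib[symmetric] divide_simps)
    have "(\<lambda>n. (- (z * of_real t)) ^ n /\<^sub>R fact n * gauss_kernel 0 \<alpha> t)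
        sums (exp (- (z * of_real t)) * gauss_kernel 0 \<alpha> t)"
      by (intro sums_mult2 exp_converges)
    thus "(\<lambda>n. (- z) ^ n / fact n * gauss_kernel 0 (\<alpha> + of_nat n) t) sums gauss_kernel z \<alpha> t"
      unfolding summand using gauss_kernel_exp[of z 0] by simp
    show "(\<Sum>n<N. norm ((- z) ^ n / fact n * gauss_kernel 0 (\<alpha> + of_nat n) t))
        \<le> norm (gauss_kernel (- of_real (norm z)) \<alpha> t)" for N
    proof (cases "t > 0")
      case True
      have "(\<Sum>n<N. (norm z * t) ^ n /\<^sub>R fact n) \<le> exp (norm z * t)"
        using True exp_converges[of "norm z * t"]
        by (intro sum_le_suminf[THEN order_trans]) (auto simp: sums_iff intro!: divide_nonneg_pos)
      hence "(\<Sum>n<N. (norm z * t) ^ n /\<^sub>R fact n) * norm (gauss_kernel 0 \<alpha> t)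
          \<le> exp (norm z * t) * norm (gauss_kernel 0 \<alpha> t)"
        by (intro mult_right_mono) auto
      thus ?thesis
        unfolding summand using True gauss_kernel_exp[of "- of_real (norm z)" 0]
        by (simp add: norm_mult norm_power sum_distrib_right mult.assoc)
    qed (simp add: gauss_kernel_def pos_powr_def)
  qed simp
  thus ?thesis
    by (simp add: gauss_moment_def)
qed

text \<open>Splitting off the first or the last factor of (1/2)_(n+1) relates (3/2)_n to (1/2)_n.
  This is the odd companion of \<open>fact_double\<close>, used for the odd powers of
  \<open>z\<close>.\<close>

lemma fact_double_Suc:
  "fact (2 * n + 1) = (2 ^ (2 * n) * pochhammer (3 / 2) n * fact n :: complex)"
proof -
  have "pochhammer (1 / 2 :: complex) (Suc n) = (1 / 2 + of_nat n) * pochhammer (1 / 2) n"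
    by (rule pochhammer_rec')
  moreover have "pochhammer (1 / 2 :: complex) (Suc n) = 1 / 2 * pochhammer (3 / 2) n"
    by (simp add: pochhammer_rec)
  ultimately have "pochhammer (3 / 2 :: complex) n = (2 * of_nat n + 1) * pochhammer (1 / 2) n"
    by (simp add: field_simps)
  moreover have "fact (2 * n + 1) = (2 * of_nat n + 1) * (fact (2 * n) :: complex)"
    by simp
  ultimately show ?thesis
    using fact_double[of n, where ?'a = complex] by (simp add: algebra_simps)
qed

lemma not_nonpos_Int_of_Re_pos: "Re z > 0 \<Longrightarrow> z \<notin> \<int>\<^sub>\<le>\<^sub>0"
  by (auto simp: complex_nonpos_Reals_iff dest: nonpos_Ints_subset_nonpos_Reals [THEN subsetD])

text \<open>Raising \<alpha> by 2n raises the Gamma argument \<alpha>/2 by n, and the functional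
  equation extracts a Pochhammer symbol.\<close>

lemma gauss_moment_0_add_nat:
  assumes "Re \<alpha> > 0"
  shows "gauss_moment 0 (\<alpha> + 2 * of_nat n) =
    2 powr (\<alpha> / 2 - 1) * Gamma (\<alpha> / 2) * 2 ^ n * pochhammer (\<alpha> / 2) n"
proof -
  have re: "Re (\<alpha> / 2) > 0" "Re (\<alpha> + 2 * of_nat n) > 0"
    using assms by (simp_all add: add_pos_nonneg)
  have "Gamma (\<alpha> / 2 + of_nat n) = Gamma (\<alpha> / 2) * pochhammer (\<alpha> / 2) n"
    using pochhammer_Gamma[OF not_nonpos_Int_of_Re_pos[OF re(1)]] not_nonpos_Int_of_Re_pos[OF re(1)]
    by (simp add: Gamma_eq_zero_iff)
  moreover have "(\<alpha> + 2 * of_nat n) / 2 = \<alpha> / 2 + of_nat n"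
    by simp
  moreover have "(2::complex) powr (\<alpha> / 2 + of_nat n - 1) = 2 powr (\<alpha> / 2 - 1) * 2 ^ n"
    using powr_add[of "2::complex" "\<alpha> / 2 - 1" "of_nat n"] by (simp add: algebra_simps powr_nat')
  ultimately show ?thesis
    using gauss_moment_0[OF re(2)] by (simp only: mult_ac)
qed

text \<open>The even and odd powers of \<open>z\<close> are summed separately. The factorials (2n)!
  and (2n+1)! contribute (1/2)_n and (3/2)_n, the denominators of the two Kummer functions.\<close>

lemma gauss_moment_eq_kummer:
  assumes "Re \<alpha> > 0"
  shows "gauss_moment z \<alpha> =
    2 powr (\<alpha> / 2 - 1) * Gamma (\<alpha> / 2) * kummer_Phi (\<alpha> / 2) (1 / 2) (z\<^sup>2 / 2)
    - z * (2 powr ((\<alpha> + 1) / 2 - 1) * Gamma ((\<alpha> + 1) / 2)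
        * kummer_Phi ((\<alpha> + 1) / 2) (3 / 2) (z\<^sup>2 / 2))" (is "_ = ?A - ?B")
proof -
  define f where "f = (\<lambda>n. (- z) ^ n / fact n * gauss_moment 0 (\<alpha> + of_nat n))"
  have re: "Re (\<alpha> + 1) > 0"
    using assms by simp
  \<comment> \<open>Here \<open>t\<close> stands for 2^n: the factor 4^n of the doubled factorial
    cancels against the 2^n of the moment, leaving the 2^n in (z^2/2)^n.\<close>
  have cancel: "C * (P / H * (Z / t / F)) = Z / (t * t * H * F) * (C * t * P)"
    if "t \<noteq> 0" for C P H Z t F :: complex
    using that by (auto simp: divide_simps)
  have pow: "z ^ (2 * n) = (z\<^sup>2) ^ n" "(2::complex) ^ (2 * n) = 2 ^ n * 2 ^ n" for n
    by (simp only: power_mult) (simp only: mult_2 power_add)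
  have "(\<lambda>n. 2 powr (\<alpha> / 2 - 1) * Gamma (\<alpha> / 2)
      * (pochhammer (\<alpha> / 2) n / pochhammer (1 / 2) n * ((z\<^sup>2 / 2) ^ n / fact n))) sums ?A"
    unfolding kummer_Phi_def using summable_kummer[of "1/2"]
    by (intro sums_mult summable_sums) auto
  moreover have "2 powr (\<alpha> / 2 - 1) * Gamma (\<alpha> / 2)
      * (pochhammer (\<alpha> / 2) n / pochhammer (1 / 2) n * ((z\<^sup>2 / 2) ^ n / fact n)) = f (2 * n)" for n
    unfolding f_def using gauss_moment_0_add_nat[OF assms, of n]
    by (simp add: fact_double pow power_divide cancel) (simp only: mult_ac)
  ultimately have A: "(\<lambda>n. f (2 * n)) sums ?A"
    by simp
  have "(\<lambda>n. - z * (2 powr ((\<alpha> + 1) / 2 - 1) * Gamma ((\<alpha> + 1) / 2)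
      * (pochhammer ((\<alpha> + 1) / 2) n / pochhammer (3 / 2) n * ((z\<^sup>2 / 2) ^ n / fact n)))) sums (- z * (2 powr ((\<alpha> + 1) / 2 - 1) * Gamma ((\<alpha> + 1) / 2)
        * kummer_Phi ((\<alpha> + 1) / 2) (3 / 2) (z\<^sup>2 / 2)))"
    unfolding kummer_Phi_def using summable_kummer[of "3/2"]
    by (intro sums_mult summable_sums) auto
  moreover have "- z * (2 powr ((\<alpha> + 1) / 2 - 1) * Gamma ((\<alpha> + 1) / 2)
      * (pochhammer ((\<alpha> + 1) / 2) n / pochhammer (3 / 2) n * ((z\<^sup>2 / 2) ^ n / fact n))) = f (2 * n + 1)" for n
  proof -
    have "f (2 * n + 1) = (- z) ^ (2 * n + 1) / fact (2 * n + 1) * gauss_moment 0 (\<alpha> + 1 + 2 * of_nat n)"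
      unfolding f_def by (simp add: algebra_simps)
    thus ?thesis
      unfolding fact_double_Suc gauss_moment_0_add_nat[OF re]
      by (simp add: pow power_divide cancel) (simp only: mult_ac)
  qed
  ultimately have B: "(\<lambda>n. f (2 * n + 1)) sums (- ?B)"
    by simp
  have "f sums gauss_moment z \<alpha>"
    unfolding f_def by (rule gauss_moment_sums[OF assms])
  \<comment> \<open>Grouping the series in pairs gives the sum of its even and odd subseries, and
    limits are unique.\<close>
  from sums_group[OF this, of 2] have "(\<lambda>n. f (2 * n) + f (2 * n + 1)) sums gauss_moment z \<alpha>"
    by (simp add: mult.commute numeral_2_eq_2)
  from sums_unique2[OF this sums_add[OF A B]] show ?thesis
    by simp
qed

text \<open>The two Kummer functions are those in the definition of
  \<open>parabolic_cylinder_D\<close>; the duplication formula, applied at \<alpha>/2, matches the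
  coefficients.\<close>

lemma gauss_moment_eq_parabolic_cylinder_D:
  assumes "Re \<alpha> > 0"
  shows "gauss_moment z \<alpha> = Gamma \<alpha> * exp (z\<^sup>2 / 4) * parabolic_cylinder_D (- \<alpha>) z"
proof -
  define P where "P = kummer_Phi (\<alpha> / 2) (1 / 2) (z\<^sup>2 / 2)"
  define Q where "Q = kummer_Phi ((\<alpha> + 1) / 2) (3 / 2) (z\<^sup>2 / 2)"
  have re: "Re (\<alpha> / 2) > 0" "Re (\<alpha> / 2 + 1 / 2) > 0"
    using assms by simp_all
  note nonpos = not_nonpos_Int_of_Re_pos[OF re(1)] not_nonpos_Int_of_Re_pos[OF re(2)]
  define g1 where "g1 = Gamma (\<alpha> / 2)"
  define g2 where "g2 = Gamma (\<alpha> / 2 + 1 / 2)"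
  define c where "c = (2::complex) powr (\<alpha> / 2)"
  have nz: "g1 \<noteq> 0" "g2 \<noteq> 0" "c \<noteq> 0"
    using nonpos by (simp_all add: g1_def g2_def c_def Gamma_eq_zero_iff)
  have c: "(2::complex) powr (\<alpha> / 2 - 1) = c / 2" "(2::complex) powr (- \<alpha> / 2) = 1 / c"
    using powr_diff[of "2::complex" "\<alpha> / 2" 1] powr_minus[of "2::complex" "\<alpha> / 2"]
    by (simp_all add: c_def inverse_eq_divide)
  \<comment> \<open>The left side is the form in which \<open>Gamma_legendre_duplication\<close>
    gives the power 2^(1 - \<alpha>).\<close>
  have "exp ((1 - 2 * (\<alpha> / 2)) * of_real (ln 2)) = (2::complex) powr (1 - \<alpha>)"
    using Ln_of_real[of 2] by (simp add: powr_def)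
  also have "\<dots> = 2 / c\<^sup>2"
    using powr_add[of "2::complex" "\<alpha> / 2" "\<alpha> / 2"] by (simp add: c_def powr_diff power2_eq_square)
  finally have dupl: "g1 * g2 = 2 / c\<^sup>2 * of_real (sqrt pi) * Gamma \<alpha>"
    using Gamma_legendre_duplication[OF nonpos] by (simp add: g1_def g2_def)
  define w where "w = complex_of_real (sqrt 2)"
  have sq: "w\<^sup>2 = 2"
    by (simp add: w_def flip: of_real_power)
  hence w: "w \<noteq> 0"
    by auto
  have half: "(2::complex) powr (1 / 2) = w"
    using powr_of_real[of 2 "1/2"] by (simp add: powr_half_sqrt w_def)
  have "(2::complex) powr ((\<alpha> + 1) / 2 - 1) = 2 powr (\<alpha> / 2 - 1 + 1 / 2)"
    by (simp add: field_simps)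
  also have "\<dots> = c / 2 * w"
    by (simp only: powr_add c half)
  finally have c': "(2::complex) powr ((\<alpha> + 1) / 2 - 1) = c / 2 * w" .
  have gam: "Gamma (1 / 2 :: complex) = of_real (sqrt pi)" "Gamma (- 1 / 2 :: complex) = - 2 * of_real (sqrt pi)"
  proof -
    show *: "Gamma (1 / 2 :: complex) = of_real (sqrt pi)"
      by (simp add: Gamma_one_half_complex)
    \<comment> \<open>As -1/2 is not a pole, the functional equation gives \<Gamma>(-1/2) from
      \<Gamma>(1/2). Its negative sign matches the sign of the odd powers of - z in the
      moment.\<close>
    have "(- 1 / 2 :: complex) \<notin> \<int>\<^sub>\<le>\<^sub>0"
      using fraction_not_in_Ints[of 2 "- 1", where ?'a = complex] nonpos_Ints_Int by fastforce
    from Gamma_plus1[OF this] show "Gamma (- 1 / 2 :: complex) = - 2 * of_real (sqrt pi)"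
      using * by (simp add: field_simps)
  qed
  have rg: "rGamma ((1 + \<alpha>) / 2) = 1 / g2" "rGamma (\<alpha> / 2) = 1 / g1" "Gamma ((\<alpha> + 1) / 2) = g2"
    by (simp_all add: g1_def g2_def Gamma_def add_divide_distrib add.commute inverse_eq_divide)
  have D: "exp (z\<^sup>2 / 4) * parabolic_cylinder_D (- \<alpha>) z = (1 / c) *
      (of_real (sqrt pi) / g2 * P - z / w * (2 * of_real (sqrt pi) / g1) * Q)"
    using rg gam c(2)
    by (simp add: parabolic_cylinder_D_def P_def Q_def add.commute exp_minus inverse_eq_divide w_def)
  have "Gamma \<alpha> * exp (z\<^sup>2 / 4) * parabolic_cylinder_D (- \<alpha>) z =
     (Gamma \<alpha> * of_real (sqrt pi)) * ((1 / c) * (P / g2 - z / w * (2 / g1) * Q))"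
    unfolding mult.assoc D by (simp add: algebra_simps)
  \<comment> \<open>In each of the two terms one of the half-argument Gamma values cancels against
    the \<open>rGamma\<close> factor, and the other one remains.\<close>
  also have "Gamma \<alpha> * of_real (sqrt pi) = g1 * g2 * c\<^sup>2 / 2"
    using dupl nz by (simp add: field_simps)
  also have "g1 * g2 * c\<^sup>2 / 2 * ((1 / c) * (P / g2 - z / w * (2 / g1) * Q)) =
      c / 2 * g1 * P - z * (c / 2 * w * g2 * Q)"
    using nz w sq by (simp add: field_simps power2_eq_square)
  also have "\<dots> = gauss_moment z \<alpha>"
    by (simp add: gauss_moment_eq_kummer[OF assms] c c' rg P_def Q_def g1_def)
  finally show ?thesis ..
qed

section \<open>Products of Gaussian moments\<close>

lemma
  fixes f g :: "real \<Rightarrow> complex"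
  assumes f: "integrable lborel f" and g: "integrable lborel g"
  shows integrable_lborel_pair_mult: "integrable (lborel \<Otimes>\<^sub>M lborel) (\<lambda>(s, t). f s * g t)"
    and integral_lborel_pair_mult: "(\<integral>(s, t). f s * g t \<partial>(lborel \<Otimes>\<^sub>M lborel)) =
      integral\<^sup>L lborel f * integral\<^sup>L lborel g"
proof -
  have [measurable]: "f \<in> borel_measurable borel" "g \<in> borel_measurable borel"
    using f g by auto
  show int: "integrable (lborel \<Otimes>\<^sub>M lborel) (\<lambda>(s, t). f s * g t)"
  proof (rule lborel_pair.Fubini_integrable)
    show "integrable lborel (\<lambda>s. \<integral>t. norm (case (s, t) of (s, t) \<Rightarrow> f s * g t) \<partial>lborel)"
      using f by (simp add: norm_mult)
    show "AE s in lborel. integrable lborel (\<lambda>t. case (s, t) of (s, t) \<Rightarrow> f s * g t)"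
      using g by simp
  qed measurable
  show "(\<integral>(s, t). f s * g t \<partial>(lborel \<Otimes>\<^sub>M lborel)) = integral\<^sup>L lborel f * integral\<^sup>L lborel g"
    using lborel_pair.integral_fst'[OF int] by simp
qed

text \<open>The change of variables u = s + t, followed by s = u x, separates the integral: the
  powers are homogeneous, and G depends on u alone.\<close>

lemma integral_lborel_pair_convolution:
  fixes G :: "real \<Rightarrow> complex"
  assumes [measurable]: "G \<in> borel_measurable borel"
    and int: "integrable (lborel \<Otimes>\<^sub>M lborel) (\<lambda>(s, t). pos_powr \<alpha> s * pos_powr \<beta> t * G (s + t))"
  shows "(\<integral>(s, t). pos_powr \<alpha> s * pos_powr \<beta> t * G (s + t) \<partial>(lborel \<Otimes>\<^sub>M lborel)) =
    (\<integral>x. pos_powr \<alpha> x * pos_powr \<beta> (1 - x) \<partial>lborel) * (\<integral>u. pos_powr (\<alpha> + \<beta>) u * G u \<partial>lborel)"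
proof -
  define F where "F = (\<lambda>s t. pos_powr \<alpha> s * pos_powr \<beta> t * G (s + t))"
  define H where "H = (\<lambda>s u. F s (u - s))"
  have [measurable]: "(\<lambda>(s, t). F s t) \<in> borel_measurable (borel \<Otimes>\<^sub>M borel)"
    unfolding F_def by measurable
  have intF: "integrable (lborel \<Otimes>\<^sub>M lborel) (\<lambda>(s, t). F s t)"
    using int by (simp add: F_def)
  have shift: "(\<integral>u. f (u - s) \<partial>lborel) = integral\<^sup>L lborel f"
    for f :: "real \<Rightarrow> 'a::{banach, second_countable_topology}" and s
    using lborel_integral_real_affine[of 1 f "- s"] by simp
  \<comment> \<open>Exchanging the order of integration needs integrability in the sheared
    coordinates. Translation in the second variable leaves the inner integrals of norms
    unchanged.\<close>
  have intH: "integrable (lborel \<Otimes>\<^sub>M lborel) (\<lambda>(s, u). H s u)"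
  proof (rule lborel_pair.Fubini_integrable)
    show "(\<lambda>(s, u). H s u) \<in> borel_measurable (lborel \<Otimes>\<^sub>M lborel)"
      unfolding H_def F_def by measurable
    have "integrable lborel (\<lambda>s. \<integral>t. norm (F s t) \<partial>lborel)"
      using lborel_pair.integrable_fst'[OF integrable_norm[OF intF]] by simp
    thus "integrable lborel (\<lambda>s. \<integral>u. norm (case (s, u) of (s, u) \<Rightarrow> H s u) \<partial>lborel)"
      using shift[of "\<lambda>t. norm (F s t)" s for s] by (simp add: H_def)
    have "AE s in lborel. integrable lborel (F s)"
      using lborel_pair.AE_integrable_fst'[OF intF] by simp
    thus "AE s in lborel. integrable lborel (\<lambda>u. case (s, u) of (s, u) \<Rightarrow> H s u)"
      using lborel_integrable_real_affine[of "F s" 1 "- s" for s]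
      by (auto simp: H_def elim!: eventually_mono)
  qed
  have inner: "(\<integral>s. H s u \<partial>lborel) =
      (\<integral>x. pos_powr \<alpha> x * pos_powr \<beta> (1 - x) \<partial>lborel) * (pos_powr (\<alpha> + \<beta>) u * G u)" for u
  proof (cases "u > 0")
    case True
    have H_eq: "H (u * x) u = of_real u powr (\<alpha> - 1) * of_real u powr (\<beta> - 1) * G u *
        (pos_powr \<alpha> x * pos_powr \<beta> (1 - x))" for x
    proof -
      have "u - u * x = u * (1 - x)" "u * x + u * (1 - x) = u"
        by (simp_all add: algebra_simps)
      thus ?thesis
        using True by (simp only: H_def F_def pos_powr_mult) (simp add: mult_ac)
    qed
    \<comment> \<open>For fixed u > 0, the dilation s = u x contributes the factor u, which with the
      two powers makes u^(\<alpha> + \<beta> - 1).\<close>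
    have "(\<integral>s. H s u \<partial>lborel) = u *\<^sub>R (\<integral>x. H (u * x) u \<partial>lborel)"
      using True lborel_integral_real_affine[of u "\<lambda>s. H s u" 0] by simp
    also have "\<dots> = u *\<^sub>R (\<integral>x. of_real u powr (\<alpha> - 1) * of_real u powr (\<beta> - 1) * G u *
        (pos_powr \<alpha> x * pos_powr \<beta> (1 - x)) \<partial>lborel)"
      unfolding H_eq ..
    also have "\<dots> =
        (of_real u * of_real u powr (\<alpha> - 1) * of_real u powr (\<beta> - 1)) * G u *
        (\<integral>x. pos_powr \<alpha> x * pos_powr \<beta> (1 - x) \<partial>lborel)"
      by (simp add: scaleR_conv_of_real)
    also have "of_real u * of_real u powr (\<alpha> - 1) * of_real u powr (\<beta> - 1) = pos_powr (\<alpha> + \<beta>) u"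
    proof -
      have "complex_of_real u powr (\<alpha> + \<beta> - 1) = of_real u powr (1 + (\<alpha> - 1) + (\<beta> - 1))"
        by (simp add: algebra_simps)
      also have "\<dots> = of_real u * of_real u powr (\<alpha> - 1) * of_real u powr (\<beta> - 1)"
        using True by (simp only: powr_add) simp
      finally show ?thesis
        using True by (simp add: pos_powr_def)
    qed
    finally show ?thesis
      by (simp add: mult_ac)
  next
    case False
    \<comment> \<open>If u \<le> 0, then s and u - s cannot both be positive.\<close>
    hence "H s u = 0" for s
      by (auto simp: H_def F_def pos_powr_def split: split_indicator)
    thus ?thesis
      using False by (simp add: pos_powr_def)
  qed
  have "(\<integral>(s, t). F s t \<partial>(lborel \<Otimes>\<^sub>M lborel)) = (\<integral>s. (\<integral>t. F s t \<partial>lborel) \<partial>lborel)"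
    using lborel_pair.integral_fst'[OF intF] by simp
  also have "\<dots> = (\<integral>s. (\<integral>u. H s u \<partial>lborel) \<partial>lborel)"
    unfolding H_def using shift[of "F s" s for s] by simp
  also have "\<dots> = (\<integral>u. (\<integral>s. H s u \<partial>lborel) \<partial>lborel)"
    using lborel_pair.Fubini_integral[OF intH] by simp
  finally show ?thesis
    unfolding inner by (simp add: F_def)
qed

text \<open>The convolution formula with G(u) = exp (- u) expresses \<Gamma>(\<alpha>)
  \<Gamma>(\<beta>) as this integral times \<Gamma>(\<alpha> + \<beta>).\<close>

lemma Beta_eq_integral:
  assumes "Re \<alpha> > 0" "Re \<beta> > 0"
  shows "(\<integral>x. pos_powr \<alpha> x * pos_powr \<beta> (1 - x) \<partial>lborel) = Beta \<alpha> \<beta>"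
proof -
  have re: "Re (\<alpha> + \<beta>) > 0"
    using assms by simp
  have eq: "(\<lambda>(s, t). (pos_powr \<alpha> s * exp (- of_real s)) * (pos_powr \<beta> t * exp (- of_real t))) =
      (\<lambda>(s, t). pos_powr \<alpha> s * pos_powr \<beta> t * exp (- of_real (s + t)))"
    by (auto simp: fun_eq_iff exp_add exp_diff exp_minus field_simps)
  have "Gamma \<alpha> * Gamma \<beta> =
      (\<integral>x. pos_powr \<alpha> x * pos_powr \<beta> (1 - x) \<partial>lborel) * Gamma (\<alpha> + \<beta>)"
    using integral_lborel_pair_convolution[of "\<lambda>u. exp (- of_real u)" \<alpha> \<beta>]
      integrable_lborel_pair_mult[OF integrable_pos_powr_exp[OF assms(1)] integrable_pos_powr_exp[OF assms(2)]]
      integral_lborel_pair_mult[OF integrable_pos_powr_exp[OF assms(1)] integrable_pos_powr_exp[OF assms(2)]]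
    by (simp only: eq integral_pos_powr_exp assms re) simp
  thus ?thesis
    using not_nonpos_Int_of_Re_pos[OF re] by (simp add: Beta_def Gamma_eq_zero_iff)
qed

lemma gauss_moment_mult_sums:
  assumes \<alpha>: "Re \<alpha> > 0" and \<beta>: "Re \<beta> > 0"
  shows "(\<lambda>n. Beta (\<alpha> + of_nat n) (\<beta> + of_nat n) / fact n * gauss_moment z (\<alpha> + \<beta> + 2 * of_nat n))
     sums (gauss_moment z \<alpha> * gauss_moment z \<beta>)"
proof -
  define G where "G = (\<lambda>u. exp (- (z * of_real u) - (of_real u :: complex)\<^sup>2 / 2))"
  define K where "K = (\<lambda>(s, t). gauss_kernel z \<alpha> s * gauss_kernel z \<beta> t)"
  define f where "f = (\<lambda>n (s, t). pos_powr (\<alpha> + of_nat n) s * pos_powr (\<beta> + of_nat n) t * G (s + t))"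
  have [measurable]: "G \<in> borel_measurable borel"
    unfolding G_def by measurable
  have f_meas: "f n \<in> borel_measurable (lborel \<Otimes>\<^sub>M lborel)" for n
    unfolding f_def by measurable
  have K: "integrable (lborel \<Otimes>\<^sub>M lborel) K"
    "(\<integral>x. K x \<partial>(lborel \<Otimes>\<^sub>M lborel)) = gauss_moment z \<alpha> * gauss_moment z \<beta>"
    unfolding K_def gauss_moment_def
    using integrable_lborel_pair_mult integral_lborel_pair_mult integrable_gauss_kernel assms by blast+
  have K_eq: "K (s, t) = exp (of_real (s * t)) * (pos_powr \<alpha> s * pos_powr \<beta> t * G (s + t))" for s t
  proof -
    have "exp (of_real (s * t)) * G (s + t) =
        exp (- (z * of_real s) - (of_real s)\<^sup>2 / 2) * exp (- (z * of_real t) - (of_real t)\<^sup>2 / 2)"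
      unfolding G_def exp_add[symmetric] by (intro arg_cong[of _ _ exp]) (simp add: field_simps power2_eq_square)
    thus ?thesis
      by (simp add: K_def gauss_kernel_def mult_ac)
  qed
  have f_eq: "f n (s, t) /\<^sub>R fact n =
      ((of_real (s * t)) ^ n /\<^sub>R fact n) * (pos_powr \<alpha> s * pos_powr \<beta> t * G (s + t))" for n s t
    by (simp add: f_def pos_powr_add_nat power_mult_distrib)
  \<comment> \<open>On the support s, t > 0 the expansion of exp (s t) has positive terms, so the
    full product kernel \<open>K\<close> majorizes every partial sum of norms.\<close>
  have bound: "(\<Sum>n<N. norm (f n x /\<^sub>R fact n)) \<le> norm (K x)" for x N
  proof (cases x)
    case (Pair s t)
    show ?thesis
    proof (cases "s > 0 \<and> t > 0")
      case True
      have "(\<Sum>n<N. (s * t) ^ n /\<^sub>R fact n) \<le> exp (s * t)"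
        using True exp_converges[of "s * t"]
        by (intro sum_le_suminf[THEN order_trans]) (auto simp: sums_iff)
      hence "(\<Sum>n<N. (s * t) ^ n /\<^sub>R fact n) * norm (pos_powr \<alpha> s * pos_powr \<beta> t * G (s + t))
          \<le> exp (s * t) * norm (pos_powr \<alpha> s * pos_powr \<beta> t * G (s + t))"
        by (intro mult_right_mono) auto
      moreover have "norm (f n x /\<^sub>R fact n) = (s * t) ^ n /\<^sub>R fact n * norm (pos_powr \<alpha> s * pos_powr \<beta> t * G (s + t))" for n
        unfolding Pair f_eq norm_mult using True by (simp add: norm_mult norm_power power_mult_distrib)
      moreover have "norm (K x) = exp (s * t) * norm (pos_powr \<alpha> s * pos_powr \<beta> t * G (s + t))"
        unfolding Pair K_eq norm_mult by simp
      ultimately show ?thesis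
        by (simp only: sum_distrib_right)
    next
      case False
      hence "f n x = 0" for n
        by (auto simp: Pair f_def pos_powr_def)
      thus ?thesis by simp
    qed
  qed
  have int: "integrable (lborel \<Otimes>\<^sub>M lborel) (\<lambda>x. f n x /\<^sub>R fact n)" for n
  proof (rule Bochner_Integration.integrable_bound[OF K(1)])
    \<comment> \<open>A single term is at most the partial sum ending with it, so the same majorant
      gives integrability of each term.\<close>
    have "norm (f n x /\<^sub>R fact n) \<le> norm (K x)" for x
      using bound[of x "Suc n"] sum_nonneg[of "{..<n}" "\<lambda>n. norm (f n x /\<^sub>R fact n)"]
      unfolding sum.lessThan_Suc by simp
    thus "AE x in lborel \<Otimes>\<^sub>M lborel. norm (f n x /\<^sub>R fact n) \<le> norm (K x)"
      by simp
  qed (use f_meas[of n] in measurable)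
  have "(\<lambda>n. \<integral>x. f n x /\<^sub>R fact n \<partial>(lborel \<Otimes>\<^sub>M lborel)) sums (\<integral>x. K x \<partial>(lborel \<Otimes>\<^sub>M lborel))"
  proof (rule sums_integral_dominated[OF int integrable_norm[OF K(1)] bound])
    fix x :: "real \<times> real"
    show "(\<lambda>n. f n x /\<^sub>R fact n) sums K x"
      by (cases x) (simp only: f_eq K_eq sums_mult2 exp_converges)
  qed (use K(1) in auto)
  moreover have "(\<integral>x. f n x /\<^sub>R fact n \<partial>(lborel \<Otimes>\<^sub>M lborel)) =
      Beta (\<alpha> + of_nat n) (\<beta> + of_nat n) / fact n * gauss_moment z (\<alpha> + \<beta> + 2 * of_nat n)" for n
  proof -
    have re: "Re (\<alpha> + of_nat n) > 0" "Re (\<beta> + of_nat n) > 0"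
      using assms by (simp_all add: add_pos_nonneg)
    have "integrable (lborel \<Otimes>\<^sub>M lborel) (f n)"
      using integrable_scaleR_right[OF int[of n], of "fact n"] by simp
    hence "(\<integral>x. f n x \<partial>(lborel \<Otimes>\<^sub>M lborel)) = Beta (\<alpha> + of_nat n) (\<beta> + of_nat n) *
        (\<integral>u. pos_powr (\<alpha> + of_nat n + (\<beta> + of_nat n)) u * G u \<partial>lborel)"
      unfolding f_def Beta_eq_integral[OF re, symmetric]
      by (intro integral_lborel_pair_convolution) auto
    also have "(\<integral>u. pos_powr (\<alpha> + of_nat n + (\<beta> + of_nat n)) u * G u \<partial>lborel) =
        gauss_moment z (\<alpha> + \<beta> + 2 * of_nat n)"
      by (simp add: gauss_moment_def gauss_kernel_def G_def algebra_simps)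
    finally show ?thesis
      by (simp add: scaleR_conv_of_real divide_inverse)
  qed
  ultimately show ?thesis
    using K(2) by simp
qed

section \<open>The hypergeometric integral\<close>

text \<open>For Re z \<ge> 0 the factor exp (- z t) has modulus at most 1 on t > 0. What remains is
  a moment at 0 with real parameter, which is known exactly.\<close>

lemma integral_norm_gauss_kernel_le:
  assumes "Re z \<ge> 0" "Re \<gamma> > 0"
  shows "(\<integral>t. norm (gauss_kernel z (\<gamma> + 2 * of_nat n) t) \<partial>lborel)
    \<le> (\<integral>t. norm (gauss_kernel 0 \<gamma> t) \<partial>lborel) * 2 ^ n * pochhammer (Re \<gamma> / 2) n"
proof -
  have re: "Re (\<gamma> + 2 * of_nat n) > 0"
    using assms by (simp add: add_pos_nonneg)
  have "(\<integral>t. norm (gauss_kernel z (\<gamma> + 2 * of_nat n) t) \<partial>lborel)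
      \<le> (\<integral>t. norm (gauss_kernel 0 (\<gamma> + 2 * of_nat n) t) \<partial>lborel)"
    using assms re by (intro integral_mono integrable_norm integrable_gauss_kernel norm_gauss_kernel_le)
  also have "\<dots> = (\<integral>t. norm (gauss_kernel 0 \<gamma> t) \<partial>lborel) * 2 ^ n * pochhammer (Re \<gamma> / 2) n"
  proof -
    have "complex_of_real (\<integral>t. norm (gauss_kernel 0 (\<gamma> + 2 * of_nat n) t) \<partial>lborel) =
        gauss_moment 0 (of_real (Re \<gamma>) + 2 * of_nat n)"
      using integral_norm_gauss_kernel[of 0 "\<gamma> + 2 * of_nat n"] by simp
    also have "\<dots> = gauss_moment 0 (of_real (Re \<gamma>)) * 2 ^ n * pochhammer (of_real (Re \<gamma> / 2)) n"
      using assms gauss_moment_0_add_nat[of "of_real (Re \<gamma>)" n] gauss_moment_0[of "of_real (Re \<gamma>)"] by simp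
    also have "gauss_moment 0 (of_real (Re \<gamma>)) = of_real (\<integral>t. norm (gauss_kernel 0 \<gamma> t) \<partial>lborel)"
      using integral_norm_gauss_kernel[of 0 \<gamma>] by simp
    also have "\<dots> * 2 ^ n * pochhammer (of_real (Re \<gamma> / 2)) n =
        complex_of_real ((\<integral>t. norm (gauss_kernel 0 \<gamma> t) \<partial>lborel) * 2 ^ n * pochhammer (Re \<gamma> / 2) n)"
      by (simp only: pochhammer_of_real of_real_mult of_real_power of_real_numeral)
    finally show ?thesis
      by (simp only: of_real_eq_iff)
  qed
  finally show ?thesis .
qed

text \<open>The growth 2^n (Re \<gamma>/2)_n of the moments cancels against part of (\<gamma>)_(2n),
  leaving a term of Gauss's series at 1/2. The bound is uniform in \<open>a\<close> and
  \<open>b\<close> on discs, as holomorphy in a parameter requires.\<close>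

lemma gauss_series_term_le:
  fixes a b \<gamma> z :: complex and A B :: real and n :: nat
  assumes "norm a \<le> A" "norm b \<le> B" "Re \<gamma> > 0" "Re z \<ge> 0"
  shows "norm (pochhammer a n * pochhammer b n / (pochhammer \<gamma> (2 * n) * fact n))
      * (\<integral>t. norm (gauss_kernel z (\<gamma> + 2 * of_nat n) t) \<partial>lborel)
    \<le> (\<integral>t. norm (gauss_kernel 0 \<gamma> t) \<partial>lborel) *
       (pochhammer A n * pochhammer B n / pochhammer ((Re \<gamma> + 1) / 2) n * ((1 / 2) ^ n / fact n))"
proof -
  define C where "C = (\<integral>t. norm (gauss_kernel 0 \<gamma> t) \<partial>lborel)"
  have "C \<ge> 0"
    unfolding C_def by simp
  define q where "q = pochhammer (Re \<gamma> / 2) n"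
  define r where "r = pochhammer ((Re \<gamma> + 1) / 2) n"
  have pos: "q > 0" "r > 0"
    unfolding q_def r_def using assms by (auto intro!: pochhammer_pos)
  have AB: "norm (pochhammer a n) \<le> pochhammer A n" "norm (pochhammer b n) \<le> pochhammer B n"
    using norm_pochhammer_le[of a n] pochhammer_mono_real[of "norm a" A n]
      norm_pochhammer_le[of b n] pochhammer_mono_real[of "norm b" B n] assms by simp_all
  hence AB_nonneg: "pochhammer A n \<ge> 0" "pochhammer B n \<ge> 0"
    by (meson norm_ge_zero order_trans)+
  have "(2::real) ^ (2 * n) = 2 ^ n * 2 ^ n"
    by (simp only: mult_2 power_add)
  \<comment> \<open>Duplication of the Pochhammer symbol exposes the factor \<open>q\<close>, which
    also occurs in the bound for the moment.\<close>
  hence "pochhammer (Re \<gamma>) (2 * n) = 2 ^ n * 2 ^ n * q * r"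
    using pochhammer_double[of "Re \<gamma> / 2" n] by (simp add: q_def r_def add_divide_distrib)
  hence "2 ^ n * 2 ^ n * q * r \<le> norm (pochhammer \<gamma> (2 * n))"
    using pochhammer_Re_le_norm[OF assms(3), of "2 * n"] by simp
  hence "norm (pochhammer a n * pochhammer b n / (pochhammer \<gamma> (2 * n) * fact n))
      \<le> pochhammer A n * pochhammer B n / ((2 ^ n * 2 ^ n * q * r) * fact n)"
    unfolding norm_mult norm_divide norm_fact using pos AB AB_nonneg
    by (intro frac_le mult_mono mult_nonneg_nonneg) auto
  hence "norm (pochhammer a n * pochhammer b n / (pochhammer \<gamma> (2 * n) * fact n))
      * (\<integral>t. norm (gauss_kernel z (\<gamma> + 2 * of_nat n) t) \<partial>lborel)
      \<le> pochhammer A n * pochhammer B n / ((2 ^ n * 2 ^ n * q * r) * fact n) * (C * 2 ^ n * q)"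
    using integral_norm_gauss_kernel_le[OF assms(4,3), of n]
    by (intro mult_mono) (auto simp: C_def q_def intro: order_trans[OF norm_ge_zero])
  also have "\<dots> = C * (pochhammer A n * pochhammer B n / r * ((1 / 2) ^ n / fact n))"
    using pos by (simp add: power_divide mult_ac)
  finally show ?thesis
    by (simp add: C_def r_def)
qed

lemma summable_gauss_series_bound:
  assumes "A > 0" "B > 0" "Re \<gamma> > 0"
  shows "summable (\<lambda>n. (\<integral>t. norm (gauss_kernel 0 \<gamma> t) \<partial>lborel) *
    (pochhammer A n * pochhammer B n / pochhammer ((Re \<gamma> + 1) / 2) n * ((1 / 2) ^ n / fact n)))"
  using assms by (intro summable_mult summable_gauss_real) auto

section \<open>Termwise integration of the 2F2 series\<close>

lemma
  assumes \<gamma>: "Re \<gamma> > 0" and z: "Re z \<ge> 0"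
  shows integrable_gauss_kernel_2F2:
      "integrable lborel (\<lambda>t. gauss_kernel z \<gamma> t
         * hypergeo_2F2 a b (\<gamma> / 2) ((\<gamma> + 1) / 2) (of_real (t\<^sup>2 / 4)))" (is ?int)
    and integral_gauss_kernel_2F2:
      "(\<integral>t. gauss_kernel z \<gamma> t * hypergeo_2F2 a b (\<gamma> / 2) ((\<gamma> + 1) / 2) (of_real (t\<^sup>2 / 4)) \<partial>lborel) =
       (\<Sum>n. pochhammer a n * pochhammer b n / (pochhammer \<gamma> (2 * n) * fact n)
          * gauss_moment z (\<gamma> + 2 * of_nat n))" (is ?eq)
proof -
  define c where "c = (\<lambda>n. pochhammer a n * pochhammer b n / (pochhammer \<gamma> (2 * n) * fact n))"
  define f where "f = (\<lambda>n t. c n * gauss_kernel z (\<gamma> + 2 * of_nat n) t)"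
  define d where "d = (\<lambda>n t. pochhammer a n * pochhammer b n / (pochhammer (\<gamma> / 2) n * pochhammer ((\<gamma> + 1) / 2) n)
           * ((of_real (t\<^sup>2 / 4)) ^ n / fact n))"
  \<comment> \<open>Duplication merges both lower parameters and the 4^n from (t^2/4)^n into
    (\<gamma>)_(2n), while t^(2n) shifts the kernel parameter by 2n.\<close>
  have f_eq: "f n t = gauss_kernel z \<gamma> t * d n t" for n t
  proof -
    have "pochhammer \<gamma> (2 * n) = 4 ^ n * pochhammer (\<gamma> / 2) n * pochhammer ((\<gamma> + 1) / 2) n"
      using pochhammer_double[of "\<gamma> / 2" n] by (simp add: add_divide_distrib power_mult)
    moreover have "gauss_kernel z (\<gamma> + 2 * of_nat n) t = (of_real (t\<^sup>2)) ^ n * gauss_kernel z \<gamma> t"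
      using gauss_kernel_add_nat[of z \<gamma> "2 * n" t] by (simp add: power_mult)
    ultimately show ?thesis
      by (simp add: f_def c_def d_def power_divide mult_ac)
  qed
  \<comment> \<open>Adding 1 to |a|, |b| and t^2/4 makes the arguments of the real majorant strictly
    positive, including when one of these vanishes.\<close>
  have d_summable: "summable (\<lambda>n. norm (d n t))" for t
  proof (rule summable_comparison_test'[where N = 0])
    show "summable (\<lambda>n. pochhammer (norm a + 1) n * pochhammer (norm b + 1) n
        / (pochhammer (Re \<gamma> / 2) n * pochhammer ((Re \<gamma> + 1) / 2) n) * ((t\<^sup>2 / 4 + 1) ^ n / fact n))"
      using \<gamma> by (intro summable_2F2_real) (auto simp: add_nonneg_pos)
    fix n :: nat
    have "norm (pochhammer a n) \<le> pochhammer (norm a + 1) n" "norm (pochhammer b n) \<le> pochhammer (norm b + 1) n"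
      using norm_pochhammer_le[of a n] pochhammer_mono_real[of "norm a" "norm a + 1" n]
        norm_pochhammer_le[of b n] pochhammer_mono_real[of "norm b" "norm b + 1" n] by simp_all
    moreover have "pochhammer (Re \<gamma> / 2) n \<le> norm (pochhammer (\<gamma> / 2) n)"
      "pochhammer ((Re \<gamma> + 1) / 2) n \<le> norm (pochhammer ((\<gamma> + 1) / 2) n)"
      using \<gamma> pochhammer_Re_le_norm[of "\<gamma> / 2" n] pochhammer_Re_le_norm[of "(\<gamma> + 1) / 2" n] by simp_all
    moreover have "(t\<^sup>2 / 4) ^ n \<le> (t\<^sup>2 / 4 + 1) ^ n"
      by (intro power_mono) auto
    moreover have "pochhammer (Re \<gamma> / 2) n > 0" "pochhammer ((Re \<gamma> + 1) / 2) n > 0"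
      using \<gamma> by (auto intro!: pochhammer_pos)
    moreover have "norm ((complex_of_real (t\<^sup>2 / 4)) ^ n) = (t\<^sup>2 / 4) ^ n"
      unfolding norm_power norm_of_real by simp
    moreover have "pochhammer (norm a + 1) n \<ge> 0" "pochhammer (norm b + 1) n \<ge> 0"
      by (auto intro!: pochhammer_nonneg add_nonneg_pos)
    ultimately have "norm (d n t) \<le> pochhammer (norm a + 1) n * pochhammer (norm b + 1) n
        / (pochhammer (Re \<gamma> / 2) n * pochhammer ((Re \<gamma> + 1) / 2) n) * ((t\<^sup>2 / 4 + 1) ^ n / fact n)"
      unfolding d_def norm_mult norm_divide norm_fact
      by (intro mult_mono frac_le divide_right_mono) auto
    thus "norm (norm (d n t)) \<le> pochhammer (norm a + 1) n * pochhammer (norm b + 1) n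
        / (pochhammer (Re \<gamma> / 2) n * pochhammer ((Re \<gamma> + 1) / 2) n) * ((t\<^sup>2 / 4 + 1) ^ n / fact n)"
      by simp
  qed
  have sum_eq: "(\<Sum>n. f n t) = gauss_kernel z \<gamma> t * hypergeo_2F2 a b (\<gamma> / 2) ((\<gamma> + 1) / 2) (of_real (t\<^sup>2 / 4))" for t
    using suminf_mult[OF summable_norm_cancel[OF d_summable], of "gauss_kernel z \<gamma> t" t]
    by (simp only: f_eq hypergeo_2F2_def d_def)
  have f_int: "integrable lborel (f n)" for n
    unfolding f_def using \<gamma> by (intro integrable_mult_right integrable_gauss_kernel) (simp add: add_pos_nonneg)
  have ae: "AE t in lborel. summable (\<lambda>n. norm (f n t))"
    unfolding f_eq norm_mult using d_summable by (intro AE_I2 summable_mult)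
  have norms: "summable (\<lambda>n. \<integral>t. norm (f n t) \<partial>lborel)"
  proof (rule summable_comparison_test'[where N = 0])
    show "summable (\<lambda>n. (\<integral>t. norm (gauss_kernel 0 \<gamma> t) \<partial>lborel) *
      (pochhammer (norm a + 1) n * pochhammer (norm b + 1) n / pochhammer ((Re \<gamma> + 1) / 2) n * ((1 / 2) ^ n / fact n)))"
      using \<gamma> by (intro summable_gauss_series_bound) (auto simp: add_nonneg_pos)
    fix n
    have "(\<integral>t. norm (f n t) \<partial>lborel) =
        norm (c n) * (\<integral>t. norm (gauss_kernel z (\<gamma> + 2 * of_nat n) t) \<partial>lborel)"
      by (simp add: f_def norm_mult)
    also have "\<dots> \<le> (\<integral>t. norm (gauss_kernel 0 \<gamma> t) \<partial>lborel) *
      (pochhammer (norm a + 1) n * pochhammer (norm b + 1) n / pochhammer ((Re \<gamma> + 1) / 2) n * ((1 / 2) ^ n / fact n))"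
      unfolding c_def using \<gamma> z by (intro gauss_series_term_le) auto
    finally show "norm (\<integral>t. norm (f n t) \<partial>lborel) \<le> (\<integral>t. norm (gauss_kernel 0 \<gamma> t) \<partial>lborel) *
      (pochhammer (norm a + 1) n * pochhammer (norm b + 1) n / pochhammer ((Re \<gamma> + 1) / 2) n * ((1 / 2) ^ n / fact n))"
      by simp
  qed
  show ?int
    using integrable_suminf[OF f_int ae norms] unfolding sum_eq .
  show ?eq
    using integral_suminf[OF f_int ae norms] unfolding sum_eq
    by (simp add: f_def c_def gauss_moment_def)
qed

text \<open>With the sum of the two parameters held at \<gamma>, the moments and denominators are
  constants and each term is a polynomial in \<open>a\<close>. The term bound supplies a majorant on
  every disc.\<close>

lemma holomorphic_gauss_series:
  assumes "Re \<gamma> > 0" "Re z \<ge> 0"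
  shows "(\<lambda>a. \<Sum>n. pochhammer a n * pochhammer (\<gamma> - a) n / (pochhammer \<gamma> (2 * n) * fact n)
    * gauss_moment z (\<gamma> + 2 * of_nat n)) holomorphic_on UNIV"
proof (rule holomorphic_suminf)
  fix R :: real assume R: "R > 0"
  define M where "M = (\<lambda>n. (\<integral>t. norm (gauss_kernel 0 \<gamma> t) \<partial>lborel) *
    (pochhammer R n * pochhammer (norm \<gamma> + R) n / pochhammer ((Re \<gamma> + 1) / 2) n * ((1 / 2) ^ n / fact n)))"
  have "norm (pochhammer a n * pochhammer (\<gamma> - a) n / (pochhammer \<gamma> (2 * n) * fact n)
      * gauss_moment z (\<gamma> + 2 * of_nat n)) \<le> M n" if "norm a \<le> R" for a n
  proof -
    have "norm (\<gamma> - a) \<le> norm \<gamma> + R"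
      using norm_triangle_ineq4[of \<gamma> a] that by simp
    note le = gauss_series_term_le[OF that this assms, of n]
    have "norm (gauss_moment z (\<gamma> + 2 * of_nat n)) \<le> (\<integral>t. norm (gauss_kernel z (\<gamma> + 2 * of_nat n) t) \<partial>lborel)"
      unfolding gauss_moment_def by (rule integral_norm_bound)
    from mult_left_mono[OF this norm_ge_zero] le show ?thesis
      unfolding M_def norm_mult by (rule order_trans)
  qed
  moreover have "summable M"
    unfolding M_def using R assms by (intro summable_gauss_series_bound) (auto simp: add_nonneg_pos)
  ultimately show "\<exists>M. summable M \<and> (\<forall>n a. norm a \<le> R \<longrightarrow>
      norm (pochhammer a n * pochhammer (\<gamma> - a) n / (pochhammer \<gamma> (2 * n) * fact n)
      * gauss_moment z (\<gamma> + 2 * of_nat n)) \<le> M n)"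
    by blast
next
  fix n
  have "pochhammer (Re \<gamma>) (2 * n) > 0"
    using assms by (intro pochhammer_pos)
  hence "pochhammer \<gamma> (2 * n) \<noteq> 0"
    using pochhammer_Re_le_norm[OF assms(1), of "2 * n"] by auto
  thus "(\<lambda>a. pochhammer a n * pochhammer (\<gamma> - a) n / (pochhammer \<gamma> (2 * n) * fact n)
    * gauss_moment z (\<gamma> + 2 * of_nat n)) holomorphic_on UNIV"
    by (intro holomorphic_intros) auto
qed

section \<open>The product formula on a strip and its analytic continuation\<close>

text \<open>Writing Beta(\<alpha> + n, \<beta> + n) with Pochhammer symbols extracts the constant
  \<Gamma>(\<alpha>) \<Gamma>(\<beta>) / \<Gamma>(\<alpha> + \<beta>) from the series for the
  product of moments. The product carries the same nonzero constant, so it cancels.\<close>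

lemma parabolic_cylinder_D_mult_strip:
  assumes "Re \<alpha> > 0" "Re \<beta> > 0"
  shows "exp (z\<^sup>2 / 2) * parabolic_cylinder_D (- \<alpha>) z * parabolic_cylinder_D (- \<beta>) z =
    rGamma (\<alpha> + \<beta>) * (\<Sum>n. pochhammer \<alpha> n * pochhammer \<beta> n / (pochhammer (\<alpha> + \<beta>) (2 * n) * fact n)
       * gauss_moment z (\<alpha> + \<beta> + 2 * of_nat n))"
proof -
  have re: "Re (\<alpha> + \<beta>) > 0"
    using assms by simp
  note nonpos = not_nonpos_Int_of_Re_pos[OF assms(1)] not_nonpos_Int_of_Re_pos[OF assms(2)]
    not_nonpos_Int_of_Re_pos[OF re]
  have nz: "Gamma \<alpha> \<noteq> 0" "Gamma \<beta> \<noteq> 0" "Gamma (\<alpha> + \<beta>) \<noteq> 0"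
    using nonpos by (simp_all add: Gamma_eq_zero_iff)
  hence c_nz: "Gamma \<alpha> * Gamma \<beta> * rGamma (\<alpha> + \<beta>) \<noteq> 0"
    by (simp add: rGamma_inverse_Gamma)
  have E: "exp (z\<^sup>2 / 2) = exp (z\<^sup>2 / 4) * exp (z\<^sup>2 / 4)"
    by (simp flip: exp_add)
  have "Beta (\<alpha> + of_nat n) (\<beta> + of_nat n) / fact n * gauss_moment z (\<alpha> + \<beta> + 2 * of_nat n) =
     Gamma \<alpha> * Gamma \<beta> * rGamma (\<alpha> + \<beta>) * (pochhammer \<alpha> n * pochhammer \<beta> n
       / (pochhammer (\<alpha> + \<beta>) (2 * n) * fact n) * gauss_moment z (\<alpha> + \<beta> + 2 * of_nat n))" for n
  proof -
    have "Gamma (\<alpha> + of_nat n) = pochhammer \<alpha> n * Gamma \<alpha>" "Gamma (\<beta> + of_nat n) = pochhammer \<beta> n * Gamma \<beta>"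
      using pochhammer_Gamma[OF nonpos(1), of n] pochhammer_Gamma[OF nonpos(2), of n] nz by simp_all
    moreover have "Gamma (\<alpha> + of_nat n + (\<beta> + of_nat n)) = pochhammer (\<alpha> + \<beta>) (2 * n) * Gamma (\<alpha> + \<beta>)"
      using pochhammer_Gamma[OF nonpos(3), of "2 * n"] nz by (simp add: algebra_simps)
    ultimately show ?thesis
      by (simp add: Beta_def rGamma_inverse_Gamma divide_inverse mult_ac)
  qed
  hence "(\<lambda>n. Gamma \<alpha> * Gamma \<beta> * rGamma (\<alpha> + \<beta>) * (pochhammer \<alpha> n * pochhammer \<beta> n
       / (pochhammer (\<alpha> + \<beta>) (2 * n) * fact n) * gauss_moment z (\<alpha> + \<beta> + 2 * of_nat n)))
      sums (gauss_moment z \<alpha> * gauss_moment z \<beta>)"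
    using gauss_moment_mult_sums[OF assms, of z] by simp
  moreover have "gauss_moment z \<alpha> * gauss_moment z \<beta> =
      Gamma \<alpha> * Gamma \<beta> * rGamma (\<alpha> + \<beta>) * (Gamma (\<alpha> + \<beta>)
        * (exp (z\<^sup>2 / 2) * parabolic_cylinder_D (- \<alpha>) z * parabolic_cylinder_D (- \<beta>) z))"
    using nz by (simp add: gauss_moment_eq_parabolic_cylinder_D assms E rGamma_inverse_Gamma)
  ultimately have "(\<lambda>n. pochhammer \<alpha> n * pochhammer \<beta> n
       / (pochhammer (\<alpha> + \<beta>) (2 * n) * fact n) * gauss_moment z (\<alpha> + \<beta> + 2 * of_nat n))
      sums (Gamma (\<alpha> + \<beta>)
        * (exp (z\<^sup>2 / 2) * parabolic_cylinder_D (- \<alpha>) z * parabolic_cylinder_D (- \<beta>) z))"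
    by (simp only: sums_mult_iff[OF c_nz])
  from sums_unique[OF this, symmetric] show ?thesis
    using nz by (simp add: rGamma_inverse_Gamma)
qed

lemma parabolic_cylinder_D_mult:
  assumes "Re (\<alpha> + \<beta>) > 0" "Re z \<ge> 0"
  shows "exp (z\<^sup>2 / 2) * parabolic_cylinder_D (- \<alpha>) z * parabolic_cylinder_D (- \<beta>) z =
    rGamma (\<alpha> + \<beta>) * (\<Sum>n. pochhammer \<alpha> n * pochhammer \<beta> n / (pochhammer (\<alpha> + \<beta>) (2 * n) * fact n)
       * gauss_moment z (\<alpha> + \<beta> + 2 * of_nat n))"
proof -
  define \<gamma> where "\<gamma> = \<alpha> + \<beta>"
  \<comment> \<open>The strip on which \<open>a\<close> and \<open>\<gamma> - a\<close> both have
    positive real part, so that the preceding lemma applies; it is open and contains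
    \<gamma>/2.\<close>
  define S where "S = {a. Re a > 0 \<and> Re a < Re \<gamma>}"
  have "exp (z\<^sup>2 / 2) * parabolic_cylinder_D (- \<alpha>) z * parabolic_cylinder_D (- (\<gamma> - \<alpha>)) z =
    rGamma \<gamma> * (\<Sum>n. pochhammer \<alpha> n * pochhammer (\<gamma> - \<alpha>) n / (pochhammer \<gamma> (2 * n) * fact n)
       * gauss_moment z (\<gamma> + 2 * of_nat n))"
  proof (rule analytic_continuation_open[where s = S and s' = UNIV and z = \<alpha>
      and f = "\<lambda>a. exp (z\<^sup>2 / 2) * parabolic_cylinder_D (- a) z * parabolic_cylinder_D (- (\<gamma> - a)) z"])
    show "open S"
      unfolding S_def by (intro open_Collect_conj open_Collect_less continuous_intros)
    have "\<gamma> / 2 \<in> S"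
      using assms by (simp add: S_def \<gamma>_def)
    thus "S \<noteq> {}"
      by blast
    show "(\<lambda>a. exp (z\<^sup>2 / 2) * parabolic_cylinder_D (- a) z * parabolic_cylinder_D (- (\<gamma> - a)) z)
        holomorphic_on UNIV"
      by (intro holomorphic_intros holomorphic_parabolic_cylinder_D)
    show "(\<lambda>a. rGamma \<gamma> * (\<Sum>n. pochhammer a n * pochhammer (\<gamma> - a) n / (pochhammer \<gamma> (2 * n) * fact n)
       * gauss_moment z (\<gamma> + 2 * of_nat n))) holomorphic_on UNIV"
      using assms by (intro holomorphic_intros holomorphic_gauss_series) (auto simp: \<gamma>_def)
    show "exp (z\<^sup>2 / 2) * parabolic_cylinder_D (- a) z * parabolic_cylinder_D (- (\<gamma> - a)) z =
      rGamma \<gamma> * (\<Sum>n. pochhammer a n * pochhammer (\<gamma> - a) n / (pochhammer \<gamma> (2 * n) * fact n)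
       * gauss_moment z (\<gamma> + 2 * of_nat n))" if "a \<in> S" for a
      using that parabolic_cylinder_D_mult_strip[of a "\<gamma> - a" z] by (simp add: S_def)
  qed auto
  thus ?thesis
    by (simp add: \<gamma>_def)
qed

section \<open>Rescaling and the integral representation\<close>

text \<open>With t = a u and a, u > 0 the complex powers multiply without branch corrections, and
  a^s t^(- 1 - s) becomes u^(- s - 1) / a.\<close>

lemma gauss_kernel_scale:
  assumes "a > 0"
  shows "indicator {0<..} t *\<^sub>R (exp (- p * of_real t) * of_real a powr s * of_real t powr (- (1 + s))
      * of_real (exp (- (t\<^sup>2) / (2 * a\<^sup>2)))) = gauss_kernel (of_real a * p) (- s) (t / a) / of_real a"
proof (cases "t > 0")
  case True
  define u where "u = t / a"
  have u: "u > 0" "t = a * u"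
    using True assms by (simp_all add: u_def)
  have t_powr: "complex_of_real t powr (- (1 + s)) = of_real a powr (- (1 + s)) * of_real u powr (- s - 1)"
  proof -
    have "- s - 1 = - (1 + s)"
      by simp
    thus ?thesis
      unfolding u(2) of_real_mult using assms u(1) by (simp only:) (intro powr_times_real, auto)
  qed
  have a_powr: "complex_of_real a powr s * of_real a powr (- (1 + s)) = 1 / of_real a"
    using assms powr_add[of "complex_of_real a" s "- (1 + s)"] powr_minus[of "complex_of_real a" 1]
    by (simp add: inverse_eq_divide)
  have "- (t\<^sup>2) / (2 * a\<^sup>2) = - (u\<^sup>2 / 2)"
    using assms by (simp add: u(2) power_mult_distrib)
  hence "complex_of_real (exp (- (t\<^sup>2) / (2 * a\<^sup>2))) = of_real (exp (- (u\<^sup>2 / 2)))"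
    by (simp only:)
  hence "exp (- p * of_real t) * complex_of_real (exp (- (t\<^sup>2) / (2 * a\<^sup>2))) =
      exp (- p * of_real t) * exp (- ((of_real u)\<^sup>2 / 2))"
    by (simp flip: exp_of_real)
  also have "\<dots> = exp (- (of_real a * p * of_real u) - (of_real u)\<^sup>2 / 2)"
    by (simp add: u(2) mult_ac flip: exp_add)
  finally have E: "exp (- p * of_real t) * complex_of_real (exp (- (t\<^sup>2) / (2 * a\<^sup>2))) =
      exp (- (of_real a * p * of_real u) - (of_real u)\<^sup>2 / 2)" .
  have "exp (- p * of_real t) * of_real a powr s * of_real t powr (- (1 + s))
      * of_real (exp (- (t\<^sup>2) / (2 * a\<^sup>2))) =
      exp (- (of_real a * p * of_real u) - (of_real u)\<^sup>2 / 2)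
      * ((of_real a powr s * of_real a powr (- (1 + s))) * of_real u powr (- s - 1))"
    unfolding t_powr E[symmetric] by (simp only: mult_ac)
  thus ?thesis
    using True u(1) unfolding u_def[symmetric] gauss_kernel_def pos_powr_def a_powr by simp
qed (use assms in \<open>simp add: gauss_kernel_def pos_powr_def zero_less_divide_iff\<close>)

text \<open>Integrability is part of the conclusion because the integral of a non-integrable
  function is 0 by convention.\<close>

theorem theorem4p2:
  fixes \<mu> \<nu> p :: complex and a :: real
  assumes "Re (\<mu> + \<nu>) < 0" and "a > 0" and "Re p > 0"
  shows "let f = (\<lambda>t::real.
           exp (- p * of_real t) * of_real a powr (\<mu> + \<nu>) * of_real t powr (- (1 + \<mu> + \<nu>))
           * of_real (exp (- (t\<^sup>2) / (2 * a\<^sup>2)))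
           * hypergeo_2F2 (- \<mu>) (- \<nu>) (- (\<mu> + \<nu>) / 2) ((1 - \<mu> - \<nu>) / 2)
               (of_real (t\<^sup>2 / (4 * a\<^sup>2))))
         in set_integrable lborel {0<..} f \<and>
            exp (1 / 2 * (of_real a)\<^sup>2 * p\<^sup>2)
              * parabolic_cylinder_D \<mu> (of_real a * p) * parabolic_cylinder_D \<nu> (of_real a * p)
            = 1 / Gamma (- \<mu> - \<nu>) * (LBINT t:{0<..}. f t)"
proof -
  define z where "z = of_real a * p"
  define \<gamma> where "\<gamma> = - \<mu> - \<nu>"
  define f where "f = (\<lambda>t::real.
           exp (- p * of_real t) * of_real a powr (\<mu> + \<nu>) * of_real t powr (- (1 + \<mu> + \<nu>))
           * of_real (exp (- (t\<^sup>2) / (2 * a\<^sup>2)))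
           * hypergeo_2F2 (- \<mu>) (- \<nu>) (- (\<mu> + \<nu>) / 2) ((1 - \<mu> - \<nu>) / 2)
               (of_real (t\<^sup>2 / (4 * a\<^sup>2))))"
  define h where "h = (\<lambda>u. gauss_kernel z \<gamma> u
      * hypergeo_2F2 (- \<mu>) (- \<nu>) (\<gamma> / 2) ((\<gamma> + 1) / 2) (of_real (u\<^sup>2 / 4)))"
  have re: "Re \<gamma> > 0" "Re z \<ge> 0"
    using assms by (simp_all add: \<gamma>_def z_def)
  have int_h: "integrable lborel h"
    unfolding h_def using integrable_gauss_kernel_2F2[OF re] .
  \<comment> \<open>The argument is written as an affine map of \<open>t\<close> to match the
    substitution rule for \<open>lborel\<close>; the division by \<open>a\<close> then cancels its
    Jacobian.\<close>
  have f_eq: "indicator {0<..} t *\<^sub>R f t = h (0 + (1 / a) * t) / of_real a" for t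
  proof -
    have "- (\<mu> + \<nu>) / 2 = \<gamma> / 2" "(1 - \<mu> - \<nu>) / 2 = (\<gamma> + 1) / 2" "t\<^sup>2 / (4 * a\<^sup>2) = (t / a)\<^sup>2 / 4"
      by (simp_all add: \<gamma>_def power_divide)
    hence "indicator {0<..} t *\<^sub>R f t = indicator {0<..} t *\<^sub>R (exp (- p * of_real t) * of_real a powr (\<mu> + \<nu>)
        * of_real t powr (- (1 + (\<mu> + \<nu>))) * of_real (exp (- (t\<^sup>2) / (2 * a\<^sup>2))))
        * hypergeo_2F2 (- \<mu>) (- \<nu>) (\<gamma> / 2) ((\<gamma> + 1) / 2) (of_real ((t / a)\<^sup>2 / 4))"
      by (simp only: f_def add.assoc mult_scaleR_left)
    also have "\<dots> = h (t / a) / of_real a"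
      unfolding gauss_kernel_scale[OF assms(2)] by (simp add: h_def z_def \<gamma>_def)
    finally show ?thesis by simp
  qed
  have "set_integrable lborel {0<..} f"
    unfolding set_integrable_def f_eq
    using assms(2) int_h by (intro integrable_divide lborel_integrable_real_affine) auto
  moreover have "exp (1 / 2 * (of_real a)\<^sup>2 * p\<^sup>2) * parabolic_cylinder_D \<mu> z * parabolic_cylinder_D \<nu> z =
      1 / Gamma \<gamma> * (LBINT t:{0<..}. f t)"
  proof -
    have "(LBINT t:{0<..}. f t) = integral\<^sup>L lborel h"
      unfolding set_lebesgue_integral_def f_eq
      using assms(2) lborel_integral_real_affine[of "1 / a" h 0]
      by (simp add: scaleR_conv_of_real)
    moreover have "1 / 2 * (of_real a)\<^sup>2 * p\<^sup>2 = z\<^sup>2 / 2"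
      by (simp add: z_def power_mult_distrib)
    moreover have "exp (z\<^sup>2 / 2) * parabolic_cylinder_D \<mu> z * parabolic_cylinder_D \<nu> z =
        rGamma \<gamma> * integral\<^sup>L lborel h"
      using parabolic_cylinder_D_mult[of "- \<mu>" "- \<nu>" z] integral_gauss_kernel_2F2[OF re, of "- \<mu>" "- \<nu>"] re
      by (simp add: h_def \<gamma>_def)
    ultimately show ?thesis
      by (simp only: rGamma_inverse_Gamma inverse_eq_divide)
  qed
  ultimately show ?thesis
    unfolding Let_def f_def z_def \<gamma>_def by blast
qed

end
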